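(* Let $\mathcal{G}$ be a hereditary class of graphs and let $k\geq 1$ be an integer. If $\mathcal{G}$ is degree-bounded, then the $k$-extension $\mathcal{G}^{(k)}$ of $\mathcal{G}$ is degree-bounded.
   Context: Graphs are finite and simple. A class of graphs is hereditary if it is closed under taking induced subgraphs (and isomorphism). The biclique number $\tau(G)$ is the largest integer $s$ such that $G$ contains a copy of $K_{s,s}$ as a (not necessarily induced) subgraph. The degeneracy $\delta^\star(G)$ is the least integer $d$ such that every nonempty subgraph of $G$ contains a vertex of degree at most $d$. A class $\mathcal{G}$ is degree-bounded if there exists a function $g\colon\mathbb{N}\to\mathbb{N}$ such that every $H\in\mathcal{G}$ satisfies $\delta^\star(H)\leq g(\tau(H))$. A graph $G$ is $(\mathcal{G},k)$-colourable if there exists a (not necessarily proper) edge-colouring $\varphi\colon E(G)\to\{1,\dots,k\}$ such that every monochromatic induced subgraph of $G$ (i.e. every induced subgraph of $G$ all of whose edges receive the same colour under $\varphi$) belongs to $\mathcal{G}$. The $k$-extension $\mathcal{G}^{(k)}$ is the class of all $(\mathcal{G},k)$-colourable graphs. *)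

theory Defs
  imports Main "HOL-Library.FuncSet"
begin

text \<open>
  A graph is a pair of a vertex set and a set of two-element edges. A class of graphs is a set of
  finite simple graphs over one vertex type \<open>'a\<close>. If \<open>'a\<close> is infinite (e.g. \<open>nat\<close>), every finite
  graph has an isomorphic copy over \<open>'a\<close>, so the isomorphism-closed sets of type \<open>'a graph set\<close>
  are exactly the isomorphism-closed classes of finite graphs. The null graph is admitted.
\<close>

type_synonym 'a graph = "'a set \<times> 'a set set"

abbreviation verts :: "'a graph \<Rightarrow> 'a set" where
  "verts G \<equiv> fst G"

abbreviation edges :: "'a graph \<Rightarrow> 'a set set" where
  "edges G \<equiv> snd G"

definition finite_simple_graph :: "'a graph \<Rightarrow> bool" where
  "finite_simple_graph G \<longleftrightarrow>
     finite (verts G) \<and> (\<forall>e\<in>edges G. e \<subseteq> verts G \<and> card e = 2)"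

definition subgraph :: "'a graph \<Rightarrow> 'a graph \<Rightarrow> bool" where
  "subgraph H G \<longleftrightarrow> finite_simple_graph H \<and> verts H \<subseteq> verts G \<and> edges H \<subseteq> edges G"

definition induced_subgraph :: "'a graph \<Rightarrow> 'a set \<Rightarrow> 'a graph" where
  "induced_subgraph G S = (S, {e \<in> edges G. e \<subseteq> S})"

definition isomorphic :: "'a graph \<Rightarrow> 'b graph \<Rightarrow> bool" where
  "isomorphic G H \<longleftrightarrow>
     (\<exists>f. bij_betw f (verts G) (verts H) \<and> (\<lambda>e. f ` e) ` edges G = edges H)"

definition hereditary :: "'a graph set \<Rightarrow> bool" where
  "hereditary \<G> \<longleftrightarrow>
     (\<forall>G\<in>\<G>. finite_simple_graph G) \<and>
     (\<forall>G\<in>\<G>. \<forall>S\<subseteq>verts G. induced_subgraph G S \<in> \<G>) \<and>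
     (\<forall>G\<in>\<G>. \<forall>H. finite_simple_graph H \<and> isomorphic G H \<longrightarrow> H \<in> \<G>)"

definition complete_bipartite :: "'a set \<Rightarrow> 'a set \<Rightarrow> 'a graph" where
  "complete_bipartite A B = (A \<union> B, {{a, b} | a b. a \<in> A \<and> b \<in> B})"

definition contains_biclique :: "'a graph \<Rightarrow> nat \<Rightarrow> bool" where
  "contains_biclique G s \<longleftrightarrow>
     (\<exists>A B. finite A \<and> finite B \<and> card A = s \<and> card B = s \<and> A \<inter> B = {} \<and>
        subgraph (complete_bipartite A B) G)"

definition biclique_number :: "'a graph \<Rightarrow> nat" where
  "biclique_number G = Max {s. contains_biclique G s}"

definition degree :: "'a graph \<Rightarrow> 'a \<Rightarrow> nat" where
  "degree G v = card {e \<in> edges G. v \<in> e}"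

definition degeneracy :: "'a graph \<Rightarrow> nat" where
  "degeneracy G =
     (LEAST d. \<forall>H. subgraph H G \<and> verts H \<noteq> {} \<longrightarrow> (\<exists>v\<in>verts H. degree H v \<le> d))"

definition degree_bounded :: "'a graph set \<Rightarrow> bool" where
  "degree_bounded \<G> \<longleftrightarrow>
     (\<exists>g :: nat \<Rightarrow> nat. \<forall>H\<in>\<G>. degeneracy H \<le> g (biclique_number H))"

definition monochromatic :: "('a set \<Rightarrow> nat) \<Rightarrow> 'a graph \<Rightarrow> bool" where
  "monochromatic \<phi> H \<longleftrightarrow> (\<forall>e\<in>edges H. \<forall>f\<in>edges H. \<phi> e = \<phi> f)"

definition colourable :: "'a graph set \<Rightarrow> nat \<Rightarrow> 'a graph \<Rightarrow> bool" where
  "colourable \<G> k G \<longleftrightarrow>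
     (\<exists>\<phi> \<in> edges G \<rightarrow> {1..k}. \<forall>S\<subseteq>verts G.
        monochromatic \<phi> (induced_subgraph G S) \<longrightarrow> induced_subgraph G S \<in> \<G>)"

definition extension :: "'a graph set \<Rightarrow> nat \<Rightarrow> 'a graph set" where
  "extension \<G> k = {G. finite_simple_graph G \<and> colourable \<G> k G}"

end

theory Submission
  imports Complex_Main "HOL-Library.Ramsey" Defs
begin

text \<open>
  Let \<open>G\<close> have biclique number \<open>\<tau>\<close> and degeneracy \<open>D\<close>, so that \<open>G\<close> has no clique on \<open>t = 2 (\<tau> + 1)\<close>
  vertices. It suffices to find, for \<open>D\<close> large in terms of \<open>\<tau>\<close>, \<open>k\<close> and \<open>r\<close>, disjoint independent
  sets \<open>A\<close> and \<open>B\<close> with \<open>|B| < |A|\<close> such that every vertex of \<open>A\<close> has \<open>r\<close> neighbours in \<open>B\<close> and all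
  edges between \<open>A\<close> and \<open>B\<close> have the same colour: then \<open>A \<union> B\<close> induces a monochromatic graph of
  degeneracy at least \<open>r / 4\<close> and biclique number at most \<open>\<tau>\<close>.

  Pass to an induced subgraph on \<open>n\<close> vertices of minimum degree at least \<open>D\<close>. Being
  \<open>D\<close>-degenerate, it has at least \<open>n / 2\<close> vertices of degree at most \<open>4 D\<close>, and a proportion
  \<open>1 / k\<close> of these share their majority colour \<open>c\<close>. By Ramsey's theorem a positive proportion of the
  \<open>r\<close>-subsets of a large set is independent; with Shearer's method this yields an independent set \<open>I\<close>
  of such vertices with \<open>|I| D / n\<close> as large as desired. Now sample the other vertices with
  probability of order \<open>1 / D\<close>, and delete every sampled vertex preceded by a sampled neighbour in a
  degeneracy ordering, to obtain \<open>B\<close>. Each vertex of \<open>I\<close> has, with probability bounded below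
  independently of \<open>D\<close>, exactly \<open>r\<close> neighbours in \<open>B\<close>, all through edges of colour \<open>c\<close>; so
  some outcome has more such vertices than \<open>|B|\<close>.
\<close>

section \<open>Neighbourhoods and degeneracy relative to an edge set\<close>

text \<open>Edge set and vertex set are separate arguments, so that passing to an induced subgraph
  only changes \<open>U\<close>; \<open>v\<close> itself may lie outside \<open>U\<close>. The
  condition \<open>u \<noteq> v\<close> matters because \<open>E\<close> is an arbitrary family of
  sets and may contain singletons.\<close>

definition nbrs :: "'a set set \<Rightarrow> 'a set \<Rightarrow> 'a \<Rightarrow> 'a set" where
  "nbrs E U v = {u \<in> U. u \<noteq> v \<and> {u, v} \<in> E}"

text \<open>Only induced subgraphs are tested: deleting edges can only lower degrees.\<close>

definition degenerate :: "'a set set \<Rightarrow> 'a set \<Rightarrow> nat \<Rightarrow> bool" where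
  "degenerate E V d \<longleftrightarrow> (\<forall>U\<subseteq>V. U \<noteq> {} \<longrightarrow> (\<exists>v\<in>U. card (nbrs E U v) \<le> d))"

lemma finite_nbrs [simp]: "finite U \<Longrightarrow> finite (nbrs E U v)"
  by (simp add: nbrs_def)

lemma nbrs_subset: "nbrs E U v \<subseteq> U"
  by (auto simp: nbrs_def)

lemma indep_subset: "indep S E \<Longrightarrow> T \<subseteq> S \<Longrightarrow> indep T E"
  by (auto simp: indep_def)

subsection \<open>Degenerate orderings\<close>

text \<open>Remove a vertex of degree at most \<open>d\<close>, order the rest inductively and put
  the removed vertex last; it then precedes none of its neighbours.\<close>

lemma degenerate_ordering:
  assumes "finite V" "degenerate E V d"
  shows "\<exists>ord :: 'a \<Rightarrow> nat. inj_on ord V \<and> (\<forall>v\<in>V. card {u \<in> nbrs E V v. ord u < ord v} \<le> d)"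
  using assms
proof (induction V rule: finite_psubset_induct)
  case (psubset V)
  show ?case
  proof (cases "V = {}")
    case False
    then obtain v where v: "v \<in> V" "card (nbrs E V v) \<le> d"
      using psubset.prems by (auto simp: degenerate_def)
    have "degenerate E (V - {v}) d"
      using psubset.prems by (auto simp: degenerate_def)
    then obtain ord :: "'a \<Rightarrow> nat" where ord: "inj_on ord (V - {v})"
      "\<And>u. u \<in> V - {v} \<Longrightarrow> card {w \<in> nbrs E (V - {v}) u. ord w < ord u} \<le> d"
      using psubset.IH[of "V - {v}"] v by blast
    define ord' where "ord' = ord(v := Suc (Max (ord ` V)))"
    have less: "ord u < ord' v" if "u \<in> V" for u
      using that psubset.hyps by (auto simp: ord'_def le_imp_less_Suc)
    have eq: "ord' u = ord u" if "u \<noteq> v" for u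
      using that by (simp add: ord'_def)
    have "inj_on ord' V"
    proof (rule inj_onI)
      fix u w assume "u \<in> V" "w \<in> V" "ord' u = ord' w"
      then show "u = w"
        using ord(1) less[of u] less[of w] eq[of u] eq[of w]
        by (cases "u = v"; cases "w = v") (auto dest: inj_onD)
    qed
    moreover have "card {w \<in> nbrs E V u. ord' w < ord' u} \<le> d" if "u \<in> V" for u
    proof (cases "u = v")
      case True
      have "card {w \<in> nbrs E V u. ord' w < ord' u} \<le> card (nbrs E V v)"
        using psubset.hyps True by (intro card_mono) auto
      with v show ?thesis by linarith
    next
      case False
      have "{w \<in> nbrs E V u. ord' w < ord' u} = {w \<in> nbrs E (V - {v}) u. ord w < ord u}"
      proof (rule Collect_cong)
        fix w
        show "w \<in> nbrs E V u \<and> ord' w < ord' u \<longleftrightarrow> w \<in> nbrs E (V - {v}) u \<and> ord w < ord u"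
          using False less[OF that] eq[of u] eq[of w] by (cases "w = v") (auto simp: nbrs_def)
      qed
      with ord(2)[of u] that False show ?thesis by simp
    qed
    ultimately show ?thesis by blast
  qed auto
qed

text \<open>Charging every edge to its later endpoint in a degeneracy ordering gives at most
  \<open>d * card V\<close> edges, and the degree sum counts each edge twice.\<close>

lemma degenerate_sum_degrees_le:
  assumes "finite V" "degenerate E V d"
  shows "(\<Sum>v\<in>V. card (nbrs E V v)) \<le> 2 * d * card V"
proof -
  obtain ord :: "'a \<Rightarrow> nat" where ord: "inj_on ord V"
    "\<And>v. v \<in> V \<Longrightarrow> card {u \<in> nbrs E V v. ord u < ord v} \<le> d"
    using degenerate_ordering[OF assms] by blast
  have split: "card (nbrs E V v) =
      card {u \<in> V. u \<in> nbrs E V v \<and> ord u < ord v} + card {u \<in> V. u \<in> nbrs E V v \<and> ord v < ord u}"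
    if "v \<in> V" for v
  proof -
    have "nbrs E V v =
        {u \<in> V. u \<in> nbrs E V v \<and> ord u < ord v} \<union> {u \<in> V. u \<in> nbrs E V v \<and> ord v < ord u}"
    proof (intro equalityI subsetI)
      fix u assume u: "u \<in> nbrs E V v"
      then have "ord u \<noteq> ord v"
        using inj_onD[OF ord(1), of u v] that by (auto simp: nbrs_def)
      with u show "u \<in> {u \<in> V. u \<in> nbrs E V v \<and> ord u < ord v}
          \<union> {u \<in> V. u \<in> nbrs E V v \<and> ord v < ord u}"
        using nbrs_subset[of E V v] by auto
    qed auto
    also have "card \<dots> = card {u \<in> V. u \<in> nbrs E V v \<and> ord u < ord v}
        + card {u \<in> V. u \<in> nbrs E V v \<and> ord v < ord u}"
      using assms(1) by (intro card_Un_disjoint) auto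
    finally show ?thesis .
  qed
  \<comment> \<open>Both sides count adjacent pairs, once from the earlier and once from the later
    endpoint.\<close>
  have "(\<Sum>v\<in>V. card {u \<in> V. u \<in> nbrs E V v \<and> ord v < ord u})
      = (\<Sum>u\<in>V. card {v \<in> V. v \<in> nbrs E V u \<and> ord v < ord u})"
  proof (rule sum_multicount_gen[OF assms(1) assms(1)], intro ballI)
    fix u assume "u \<in> V"
    then show "card {v \<in> V. u \<in> nbrs E V v \<and> ord v < ord u}
        = card {v \<in> V. v \<in> nbrs E V u \<and> ord v < ord u}"
      by (intro arg_cong[where f = card]) (auto simp: nbrs_def insert_commute)
  qed
  then have "(\<Sum>v\<in>V. card (nbrs E V v))
      = 2 * (\<Sum>v\<in>V. card {u \<in> V. u \<in> nbrs E V v \<and> ord u < ord v})"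
    by (simp add: split sum.distrib)
  also have "(\<Sum>v\<in>V. card {u \<in> V. u \<in> nbrs E V v \<and> ord u < ord v}) \<le> (\<Sum>v\<in>V. d)"
  proof (rule sum_mono)
    fix v assume "v \<in> V"
    moreover have "{u \<in> V. u \<in> nbrs E V v \<and> ord u < ord v} = {u \<in> nbrs E V v. ord u < ord v}"
      using nbrs_subset[of E V v] by auto
    ultimately show "card {u \<in> V. u \<in> nbrs E V v \<and> ord u < ord v} \<le> d"
      using ord(2) by simp
  qed
  finally show ?thesis by (simp add: mult.commute mult.left_commute)
qed

subsection \<open>Counting independent sets\<close>

lemma card_supersets:
  assumes "finite Y" "S \<subseteq> Y" "card S = m" "m \<le> R"
  shows "card {Z. S \<subseteq> Z \<and> Z \<subseteq> Y \<and> card Z = R} = (card Y - m) choose (R - m)"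
proof -
  have fS: "finite S" using assms finite_subset by blast
  have "{Z. S \<subseteq> Z \<and> Z \<subseteq> Y \<and> card Z = R} = (\<lambda>W. S \<union> W) ` {W. W \<subseteq> Y - S \<and> card W = R - m}"
  proof (intro equalityI subsetI)
    fix Z assume Z: "Z \<in> {Z. S \<subseteq> Z \<and> Z \<subseteq> Y \<and> card Z = R}"
    then have "Z = S \<union> (Z - S)" "Z - S \<subseteq> Y - S" "card (Z - S) = R - m"
      using fS assms by (auto simp: card_Diff_subset)
    then show "Z \<in> (\<lambda>W. S \<union> W) ` {W. W \<subseteq> Y - S \<and> card W = R - m}" by blast
  next
    fix Z assume "Z \<in> (\<lambda>W. S \<union> W) ` {W. W \<subseteq> Y - S \<and> card W = R - m}"
    then obtain W where W: "Z = S \<union> W" "W \<subseteq> Y - S" "card W = R - m" by blast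
    then have "finite W" using assms finite_subset by blast
    then have "card Z = R"
      using W fS assms by (subst W(1), subst card_Un_disjoint) auto
    with W assms show "Z \<in> {Z. S \<subseteq> Z \<and> Z \<subseteq> Y \<and> card Z = R}" by auto
  qed
  moreover have "inj_on (\<lambda>W. S \<union> W) {W. W \<subseteq> Y - S \<and> card W = R - m}"
    by (auto simp: inj_on_def)
  ultimately have "card {Z. S \<subseteq> Z \<and> Z \<subseteq> Y \<and> card Z = R} = card {W. W \<subseteq> Y - S \<and> card W = R - m}"
    by (simp add: card_image)
  also have "\<dots> = (card Y - m) choose (R - m)"
    using assms fS by (subst n_subsets) (auto simp: card_Diff_subset)
  finally show ?thesis .
qed

text \<open>Double counting: each \<open>R\<close>-subset of \<open>Y\<close> contains an
  independent \<open>m\<close>-set, and each \<open>m\<close>-set lies in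
  \<open>(card Y - m) choose (R - m)\<close> of them. The identity \<open>choose_mult\<close> turns
  the quotient into the stated proportion.\<close>

lemma many_independent_sets:
  assumes "finite Y" "R \<le> card Y"
    and R: "\<And>Z. Z \<subseteq> Y \<Longrightarrow> card Z = R \<Longrightarrow> \<exists>S\<subseteq>Z. card S = m \<and> indep S E"
  shows "card Y choose m \<le> (R choose m) * card {S. S \<subseteq> Y \<and> card S = m \<and> indep S E}"
proof -
  let ?I = "{S. S \<subseteq> Y \<and> card S = m \<and> indep S E}"
  have finI: "finite ?I" using assms(1) by simp
  obtain Z0 where "Z0 \<subseteq> Y" "card Z0 = R" using assms(2) obtain_subset_with_card_n by metis
  moreover from this have "finite Z0" using assms(1) finite_subset by blast
  ultimately have mR: "m \<le> R" using R[of Z0] card_mono by metis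
  have "card Y choose R = card {Z. Z \<subseteq> Y \<and> card Z = R}"
    using assms(1) by (simp add: n_subsets)
  also have "\<dots> \<le> card (\<Union>S\<in>?I. {Z. S \<subseteq> Z \<and> Z \<subseteq> Y \<and> card Z = R})"
  proof (rule card_mono)
    show "finite (\<Union>S\<in>?I. {Z. S \<subseteq> Z \<and> Z \<subseteq> Y \<and> card Z = R})"
      using finI assms(1) by (intro finite_UN_I) auto
    show "{Z. Z \<subseteq> Y \<and> card Z = R} \<subseteq> (\<Union>S\<in>?I. {Z. S \<subseteq> Z \<and> Z \<subseteq> Y \<and> card Z = R})"
    proof
      fix Z assume "Z \<in> {Z. Z \<subseteq> Y \<and> card Z = R}"
      moreover from this obtain S where "S \<subseteq> Z" "card S = m" "indep S E" using R by blast
      ultimately show "Z \<in> (\<Union>S\<in>?I. {Z. S \<subseteq> Z \<and> Z \<subseteq> Y \<and> card Z = R})" by blast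
    qed
  qed
  also have "\<dots> \<le> (\<Sum>S\<in>?I. card {Z. S \<subseteq> Z \<and> Z \<subseteq> Y \<and> card Z = R})"
    using finI by (rule card_UN_le)
  also have "\<dots> = card ?I * ((card Y - m) choose (R - m))"
    using card_supersets[OF assms(1) _ _ mR] by simp
  finally have "(card Y choose R) * (R choose m)
      \<le> card ?I * ((card Y - m) choose (R - m)) * (R choose m)"
    by (rule mult_le_mono1)
  also have "\<dots> = (R choose m) * card ?I * ((card Y - m) choose (R - m))"
    by (simp only: ac_simps)
  finally have "(card Y choose m) * ((card Y - m) choose (R - m))
      \<le> (R choose m) * card ?I * ((card Y - m) choose (R - m))"
    using choose_mult[OF mR assms(2)] by simp
  moreover have "(card Y - m) choose (R - m) > 0"
    using assms(2) mR by (simp add: zero_less_binomial_iff)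
  ultimately show ?thesis by simp
qed

text \<open>\<open>R\<close> is a Ramsey number for \<open>t\<close> and \<open>m\<close>. The
  result is used twice: for the average size of independent sets, and for counting independent
  \<open>r\<close>-sets in a monochromatic neighbourhood.\<close>

lemma clique_free_many_independent_sets:
  "\<exists>R. \<forall>(Y :: 'a set) E. finite Y \<and> R \<le> card Y \<and> \<not> (\<exists>K\<subseteq>Y. card K = t \<and> clique K E) \<longrightarrow>
     card Y choose m \<le> (R choose m) * card {S. S \<subseteq> Y \<and> card S = m \<and> indep S E}"
proof -
  obtain R where R: "\<And>(V :: 'a set) E. finite V \<Longrightarrow> R \<le> card V \<Longrightarrow>
      \<exists>S\<subseteq>V. card S = t \<and> clique S E \<or> card S = m \<and> indep S E"
    using ramsey2[of t m] by blast
  show ?thesis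
  proof (intro exI[of _ R] allI impI)
    fix Y :: "'a set" and E
    assume Y: "finite Y \<and> R \<le> card Y \<and> \<not> (\<exists>K\<subseteq>Y. card K = t \<and> clique K E)"
    have "\<exists>S\<subseteq>Z. card S = m \<and> indep S E" if "Z \<subseteq> Y" "card Z = R" for Z
      using R[of Z E] that Y finite_subset[of Z Y] by (metis order_refl order_trans)
    with Y show "card Y choose m \<le> (R choose m) * card {S. S \<subseteq> Y \<and> card S = m \<and> indep S E}"
      by (intro many_independent_sets) auto
  qed
qed

section \<open>Average size of independent sets and Shearer's method\<close>

text \<open>A crude bound whose exponent \<open>M - 1\<close> suffices: it is to be compared with a
  count of order \<open>card Y ^ M\<close>.\<close>

lemma card_small_subsets_le:
  assumes "finite Y" "Y \<noteq> {}" "M \<ge> 1"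
  shows "card {S. S \<subseteq> Y \<and> card S < M} \<le> M * card Y ^ (M - 1)"
proof -
  have "{S. S \<subseteq> Y \<and> card S < M} = (\<Union>j<M. {S. S \<subseteq> Y \<and> card S = j})" by auto
  then have "card {S. S \<subseteq> Y \<and> card S < M} \<le> (\<Sum>j<M. card {S. S \<subseteq> Y \<and> card S = j})"
    using card_UN_le[of "{..<M}" "\<lambda>j. {S. S \<subseteq> Y \<and> card S = j}"] by simp
  also have "\<dots> = (\<Sum>j<M. card Y choose j)"
    using assms by (simp add: n_subsets)
  also have "\<dots> \<le> (\<Sum>j<M. card Y ^ (M - 1))"
  proof (rule sum_mono)
    fix j assume "j \<in> {..<M}"
    have "card Y choose j \<le> card Y ^ j"
      by (cases "j \<le> card Y") (auto simp: binomial_le_pow binomial_eq_0)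
    also have "\<dots> \<le> card Y ^ (M - 1)"
      using assms \<open>j \<in> {..<M}\<close> by (intro power_increasing) (auto simp: Suc_le_eq card_gt_0_iff)
    finally show "card Y choose j \<le> card Y ^ (M - 1)" .
  qed
  finally show ?thesis by simp
qed

text \<open>For large \<open>Y\<close> the independent sets of size exactly \<open>2 * m\<close>
  already outnumber all sets of smaller size. Hence at least half of the independent sets have size
  at least \<open>2 * m\<close>, and the average is at least \<open>m\<close>.\<close>

lemma independent_sets_average_size:
  "\<exists>x0. \<forall>(Y :: 'a set) E. finite Y \<and> x0 \<le> card Y \<and> \<not> (\<exists>K\<subseteq>Y. card K = t \<and> clique K E) \<longrightarrow>
     m * card {S. S \<subseteq> Y \<and> indep S E} \<le> (\<Sum>S | S \<subseteq> Y \<and> indep S E. card S)"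
proof (cases "m = 0")
  case False
  define M where "M = 2 * m"
  have M: "M \<ge> 1" using False by (simp add: M_def)
  obtain R where R: "\<And>(Y :: 'a set) E. finite Y \<Longrightarrow> R \<le> card Y \<Longrightarrow>
      \<not> (\<exists>K\<subseteq>Y. card K = t \<and> clique K E) \<Longrightarrow>
      card Y choose M \<le> (R choose M) * card {S. S \<subseteq> Y \<and> card S = M \<and> indep S E}"
    using clique_free_many_independent_sets[of t M] by blast
  define C where "C = (R choose M)"
  \<comment> \<open>\<open>R\<close> makes the Ramsey count applicable, \<open>M\<close> makes the
    binomial coefficient positive, and the last summand makes \<open>x ^ M / (C * M ^ M)\<close> at
    least \<open>M * x ^ (M - 1)\<close>.\<close>
  define x0 where "x0 = Suc (R + M + C * M ^ Suc M)"
  show ?thesis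
  proof (intro exI[of _ x0] allI impI)
    fix Y :: "'a set" and E
    assume Y: "finite Y \<and> x0 \<le> card Y \<and> \<not> (\<exists>K\<subseteq>Y. card K = t \<and> clique K E)"
    let ?all = "{S. S \<subseteq> Y \<and> indep S E}"
    let ?lo = "{S \<in> ?all. card S < M}" and ?hi = "{S \<in> ?all. M \<le> card S}"
    let ?eq = "{S. S \<subseteq> Y \<and> card S = M \<and> indep S E}"
    define x where "x = card Y"
    have fin: "finite ?all" "finite Y" using Y by auto
    have x: "M \<le> x" "x > 0" "C * M ^ Suc M \<le> x"
      using Y by (auto simp: x_def x0_def)
    have count: "x choose M \<le> C * card ?eq"
      using R[of Y E] Y by (auto simp: x_def C_def x0_def)
    have "x choose M > 0" using x by (simp add: zero_less_binomial_iff)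
    with count have "C > 0" by (cases "C = 0") auto
    have "(real x / real M) ^ M \<le> real (x choose M)"
      using x(1) by (rule binomial_ge_n_over_k_pow_k)
    also have "\<dots> \<le> real C * real (card ?eq)"
      using count by (metis of_nat_mono of_nat_mult)
    finally have "real x ^ M \<le> real M ^ M * (real C * real (card ?eq))"
      using M by (simp add: power_divide field_simps)
    then have le: "x ^ M \<le> M ^ M * (C * card ?eq)"
      by (metis of_nat_le_iff of_nat_mult of_nat_power)
    have "(M ^ M * C) * (M * x ^ (M - 1)) = C * M ^ Suc M * x ^ (M - 1)" by simp
    also have "\<dots> \<le> x * x ^ (M - 1)"
      using x(3) by (rule mult_le_mono1)
    also have "\<dots> = x ^ M" using M by (simp add: power_eq_if)
    also have "\<dots> \<le> (M ^ M * C) * card ?eq" using le by (simp only: mult.assoc)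
    finally have "(M ^ M * C) * (M * x ^ (M - 1)) \<le> (M ^ M * C) * card ?eq" .
    then have "M * x ^ (M - 1) \<le> card ?eq"
      using \<open>C > 0\<close> M by simp
    moreover have "card ?lo \<le> M * x ^ (M - 1)"
    proof -
      have "card ?lo \<le> card {S. S \<subseteq> Y \<and> card S < M}"
        using fin by (intro card_mono) auto
      also have "\<dots> \<le> M * x ^ (M - 1)"
        unfolding x_def using fin x M by (intro card_small_subsets_le) (auto simp: x_def)
      finally show ?thesis .
    qed
    moreover have "card ?eq \<le> card ?hi"
      using fin by (intro card_mono) auto
    ultimately have lohi: "card ?lo \<le> card ?hi" by linarith
    have "card ?all = card (?lo \<union> ?hi)"
      by (intro arg_cong[where f = card]) auto
    also have "\<dots> = card ?lo + card ?hi"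
      using fin by (intro card_Un_disjoint) auto
    finally have "m * card ?all \<le> m * (card ?hi + card ?hi)"
      using lohi by simp
    also have "\<dots> = (\<Sum>S\<in>?hi. M)" by (simp add: M_def)
    also have "\<dots> \<le> (\<Sum>S\<in>?hi. card S)" by (intro sum_mono) auto
    also have "\<dots> \<le> (\<Sum>S\<in>?all. card S)"
      using fin by (intro sum_mono2) auto
    finally show "m * card ?all \<le> (\<Sum>S\<in>?all. card S)" .
  qed
qed auto

text \<open>
  Shearer's argument: for a uniformly random independent set \<open>I\<close>, either \<open>v\<close> is likely to lie in \<open>I\<close>
  or many neighbours of \<open>v\<close> do, because conditionally on \<open>I\<close> outside the closed neighbourhood of \<open>v\<close>
  the rest of \<open>I\<close> is either \<open>{v}\<close> or a uniform independent subset of the available neighbours.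
\<close>

lemma independent_sets_local_bound:
  fixes A :: "'a set"
  assumes fin: "finite A" and v: "v \<in> A"
    and local: "\<And>Y. Y \<subseteq> nbrs E A v \<Longrightarrow>
      m * Suc (card {S. S \<subseteq> Y \<and> indep S E}) \<le> \<Delta> + (\<Sum>S | S \<subseteq> Y \<and> indep S E. card S)"
  shows "m * card {I. I \<subseteq> A \<and> indep I E} \<le>
    (\<Sum>I | I \<subseteq> A \<and> indep I E. (if v \<in> I then \<Delta> else 0) + card (nbrs E A v \<inter> I))"
proof -
  let ?I = "{I. I \<subseteq> A \<and> indep I E}"
  let ?N = "nbrs E A v"
  define w where "w I = (if v \<in> I then \<Delta> else 0) + card (?N \<inter> I)" for I
  define \<pi> where "\<pi> I = I - insert v ?N" for I
  have finI: "finite ?I" using fin by simp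
  have fibre: "m * card {I \<in> ?I. \<pi> I = J} \<le> (\<Sum>I | I \<in> ?I \<and> \<pi> I = J. w I)" if "J \<in> \<pi> ` ?I" for J
  proof -
    from that have J: "J \<subseteq> A" "indep J E" "J \<inter> insert v ?N = {}"
      by (auto simp: \<pi>_def indep_def)
    \<comment> \<open>The neighbours of \<open>v\<close> that are still available once the part
      \<open>J\<close> outside the closed neighbourhood is fixed.\<close>
    define Y where "Y = {u \<in> ?N. \<forall>j\<in>J. {u, j} \<notin> E}"
    define \<S> where "\<S> = {S. S \<subseteq> Y \<and> indep S E}"
    have Y: "Y \<subseteq> ?N" "finite Y" using fin by (auto simp: Y_def)
    have fS: "finite \<S>" using Y by (simp add: \<S>_def)
    have vN: "v \<notin> ?N" by (auto simp: nbrs_def)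
    have eq: "{I \<in> ?I. \<pi> I = J} = insert (insert v J) ((\<lambda>S. J \<union> S) ` \<S>)"
    proof (intro equalityI subsetI)
      fix I assume "I \<in> {I \<in> ?I. \<pi> I = J}"
      then have I: "I \<subseteq> A" "indep I E" "I - insert v ?N = J" by (auto simp: \<pi>_def)
      show "I \<in> insert (insert v J) ((\<lambda>S. J \<union> S) ` \<S>)"
      proof (cases "v \<in> I")
        case True
        then have "I \<inter> ?N = {}" using I(2) by (auto simp: indep_def nbrs_def)
        then have "I = insert v J" using I(3) True by blast
        then show ?thesis by simp
      next
        case False
        have "{u, j} \<notin> E" if "u \<in> I \<inter> ?N" "j \<in> J" for u j
        proof -
          have "j \<in> I" "j \<notin> ?N" using that(2) I(3) by auto
          then show ?thesis using I(2) that(1) by (auto simp: indep_def)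
        qed
        then have "I \<inter> ?N \<in> \<S>"
          using I(2) by (auto simp: \<S>_def Y_def indep_def)
        moreover have "I = J \<union> (I \<inter> ?N)" using I(3) False by blast
        ultimately show ?thesis by blast
      qed
    next
      fix I assume "I \<in> insert (insert v J) ((\<lambda>S. J \<union> S) ` \<S>)"
      then consider "I = insert v J" | S where "S \<in> \<S>" "I = J \<union> S" by blast
      then show "I \<in> {I \<in> ?I. \<pi> I = J}"
      proof cases
        case 1
        have "{v, j} \<notin> E \<and> {j, v} \<notin> E" if "j \<in> J" for j
          using J that by (auto simp: nbrs_def insert_commute)
        then have "indep I E" using J(2) 1 by (auto simp: indep_def)
        with 1 J v show ?thesis by (auto simp: \<pi>_def)
      next
        case 2
        have "{u, j} \<notin> E \<and> {j, u} \<notin> E" if "u \<in> S" "j \<in> J" for u j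
          using 2 that by (auto simp: \<S>_def Y_def insert_commute)
        then have "indep I E" using J(2) 2 by (auto simp: indep_def \<S>_def)
        moreover have "S \<subseteq> ?N" using 2 Y by (auto simp: \<S>_def)
        moreover from this have "S \<subseteq> A" using nbrs_subset[of E A v] by auto
        ultimately show ?thesis using 2 J by (auto simp: \<pi>_def)
      qed
    qed
    have inj: "inj_on (\<lambda>S. J \<union> S) \<S>"
      using J(3) Y(1) by (auto simp: inj_on_def \<S>_def) blast+
    have SN: "S \<subseteq> ?N" if "S \<in> \<S>" for S using that Y(1) by (auto simp: \<S>_def)
    have new: "insert v J \<notin> (\<lambda>S. J \<union> S) ` \<S>"
      using vN J(3) SN by blast
    \<comment> \<open>The single set \<open>insert v J\<close> accounts for the \<open>Suc\<close>
      in the hypothesis \<open>local\<close>, and its weight for the summand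
      \<open>\<Delta>\<close>.\<close>
    have "card {I \<in> ?I. \<pi> I = J} = Suc (card \<S>)"
      unfolding eq using new fS inj by (simp add: card_image)
    moreover have "(\<Sum>I | I \<in> ?I \<and> \<pi> I = J. w I) = w (insert v J) + (\<Sum>S\<in>\<S>. w (J \<union> S))"
      using eq new fS inj by (simp add: sum.reindex)
    moreover have "(\<Sum>S\<in>\<S>. w (J \<union> S)) = (\<Sum>S\<in>\<S>. card S)"
    proof (rule sum.cong)
      fix S assume "S \<in> \<S>"
      then have "v \<notin> J \<union> S" "?N \<inter> (J \<union> S) = S" using SN vN J(3) by blast+
      then show "w (J \<union> S) = card S" by (simp add: w_def)
    qed simp
    moreover have "w (insert v J) \<ge> \<Delta>" by (simp add: w_def)
    ultimately show ?thesis
      using local[OF Y(1)] by (simp add: \<S>_def)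
  qed
  have "card ?I = (\<Sum>J\<in>\<pi> ` ?I. card {I \<in> ?I. \<pi> I = J})"
    using sum.group[OF finI finite_imageI[OF finI] order_refl, where g = \<pi> and h = "\<lambda>_. 1::nat"]
    by (simp only: card_eq_sum)
  then have "m * card ?I = (\<Sum>J\<in>\<pi> ` ?I. m * card {I \<in> ?I. \<pi> I = J})"
    by (simp add: sum_distrib_left)
  also have "\<dots> \<le> (\<Sum>J\<in>\<pi> ` ?I. \<Sum>I | I \<in> ?I \<and> \<pi> I = J. w I)"
    by (rule sum_mono) (rule fibre)
  also have "\<dots> = (\<Sum>I\<in>?I. w I)"
    by (rule sum.group[OF finI finite_imageI[OF finI] order_refl])
  finally show ?thesis by (simp add: w_def)
qed

text \<open>Gains an arbitrary factor \<open>f\<close> over the greedy bound of order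
  \<open>card A / \<Delta>\<close>. The local bound is summed over all \<open>v\<close>; an
  independent set \<open>I\<close> contributes at most \<open>2 * \<Delta> * card I\<close>, half
  from its members and half from their neighbours, so some \<open>I\<close> reaches the
  average.\<close>

lemma large_independent_set:
  "\<exists>\<Delta>0. \<forall>\<Delta>\<ge>\<Delta>0. \<forall>(A :: 'a set) E. finite A \<and> \<not> (\<exists>K\<subseteq>A. card K = t \<and> clique K E) \<and>
     (\<forall>v\<in>A. card (nbrs E A v) \<le> \<Delta>) \<longrightarrow> (\<exists>I\<subseteq>A. indep I E \<and> f * card A \<le> \<Delta> * card I)"
proof -
  define m where "m = 2 * f"
  obtain x0 where x0: "\<And>(Y :: 'a set) E. finite Y \<Longrightarrow> x0 \<le> card Y \<Longrightarrow>
      \<not> (\<exists>K\<subseteq>Y. card K = t \<and> clique K E) \<Longrightarrow>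
      2 * m * card {S. S \<subseteq> Y \<and> indep S E} \<le> (\<Sum>S | S \<subseteq> Y \<and> indep S E. card S)"
    using independent_sets_average_size[of t "2 * m"] by blast
  show ?thesis
  \<comment> \<open>If \<open>card Y < x0\<close>, there are at most \<open>2 ^ x0\<close> subsets
    and \<open>\<Delta>\<close> alone suffices. Otherwise the average size is at least
    \<open>2 * m\<close>, where the factor 2 absorbs the \<open>Suc\<close> in the local
    bound.\<close>
  proof (intro exI[of _ "m * Suc (2 ^ x0)"] allI impI)
    fix \<Delta> and A :: "'a set" and E
    assume \<Delta>: "m * Suc (2 ^ x0) \<le> \<Delta>"
      and asm: "finite A \<and> \<not> (\<exists>K\<subseteq>A. card K = t \<and> clique K E) \<and> (\<forall>v\<in>A. card (nbrs E A v) \<le> \<Delta>)"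
    let ?I = "{I. I \<subseteq> A \<and> indep I E}"
    have finA: "finite A" and fin: "finite ?I" using asm by auto
    have local: "m * Suc (card {S. S \<subseteq> Y \<and> indep S E}) \<le> \<Delta> + (\<Sum>S | S \<subseteq> Y \<and> indep S E. card S)"
      if "Y \<subseteq> A" for Y
    proof (cases "x0 \<le> card Y")
      case True
      have finY: "finite Y" using finA that finite_subset by blast
      have "{} \<in> {S. S \<subseteq> Y \<and> indep S E}" by (simp add: indep_def)
      then have "card {S. S \<subseteq> Y \<and> indep S E} \<ge> 1"
        using finY card_gt_0_iff[of "{S. S \<subseteq> Y \<and> indep S E}"] by (auto simp: Suc_le_eq)
      then have "m * Suc (card {S. S \<subseteq> Y \<and> indep S E}) \<le> m * (2 * card {S. S \<subseteq> Y \<and> indep S E})"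
        by (intro mult_le_mono2) linarith
      also have "\<dots> = 2 * m * card {S. S \<subseteq> Y \<and> indep S E}" by simp
      also have "\<dots> \<le> (\<Sum>S | S \<subseteq> Y \<and> indep S E. card S)"
        using x0[of Y E] finY True that asm by (meson order_trans)
      finally show ?thesis by linarith
    next
      case False
      have finY: "finite Y" using finA that finite_subset by blast
      have "card {S. S \<subseteq> Y \<and> indep S E} \<le> card (Pow Y)"
        using finY by (intro card_mono) auto
      also have "\<dots> \<le> 2 ^ x0" using False finY by (simp add: card_Pow)
      finally have "m * Suc (card {S. S \<subseteq> Y \<and> indep S E}) \<le> m * Suc (2 ^ x0)"
        by (intro mult_le_mono2) simp
      with \<Delta> show ?thesis by linarith
    qed
    have "card A * (m * card ?I) = (\<Sum>v\<in>A. m * card ?I)" by simp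
    also have "\<dots> \<le> (\<Sum>v\<in>A. \<Sum>I\<in>?I. (if v \<in> I then \<Delta> else 0) + card (nbrs E A v \<inter> I))"
      using nbrs_subset by (intro sum_mono independent_sets_local_bound finA local) fast+
    also have "\<dots> = (\<Sum>I\<in>?I. \<Sum>v\<in>A. (if v \<in> I then \<Delta> else 0) + card (nbrs E A v \<inter> I))"
      by (rule sum.swap)
    also have "\<dots> \<le> (\<Sum>I\<in>?I. 2 * \<Delta> * card I)"
    proof (rule sum_mono)
      fix I assume "I \<in> ?I"
      then have I: "I \<subseteq> A" "finite I" using finA finite_subset by auto
      have "(\<Sum>v\<in>A. if v \<in> I then \<Delta> else 0) = \<Delta> * card I"
        using I finA by (simp add: sum.If_cases Int_absorb1)
      moreover have "(\<Sum>v\<in>A. card (nbrs E A v \<inter> I)) = (\<Sum>u\<in>I. card (nbrs E A u))"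
      proof -
        have "(\<Sum>v\<in>A. card {u \<in> I. u \<in> nbrs E A v}) = (\<Sum>u\<in>I. card (nbrs E A u))"
        proof (rule sum_multicount_gen[OF finA I(2)], intro ballI)
          fix u assume "u \<in> I"
          then have "{v \<in> A. u \<in> nbrs E A v} = nbrs E A u"
            using I by (auto simp: nbrs_def insert_commute)
          then show "card {v \<in> A. u \<in> nbrs E A v} = card (nbrs E A u)" by simp
        qed
        moreover have "{u \<in> I. u \<in> nbrs E A v} = nbrs E A v \<inter> I" for v by auto
        ultimately show ?thesis by simp
      qed
      moreover have "(\<Sum>u\<in>I. card (nbrs E A u)) \<le> (\<Sum>u\<in>I. \<Delta>)"
        using asm I by (intro sum_mono) auto
      ultimately show "(\<Sum>v\<in>A. (if v \<in> I then \<Delta> else 0) + card (nbrs E A v \<inter> I)) \<le> 2 * \<Delta> * card I"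
        by (simp add: sum.distrib mult.commute)
    qed
    finally have total: "card A * (m * card ?I) \<le> (\<Sum>I\<in>?I. 2 * \<Delta> * card I)" .
    show "\<exists>I\<subseteq>A. indep I E \<and> f * card A \<le> \<Delta> * card I"
    proof (rule ccontr)
      assume "\<not> ?thesis"
      then have "2 * \<Delta> * card I < m * card A" if "I \<in> ?I" for I
        using that by (auto simp: m_def not_le)
      moreover have "?I \<noteq> {}" by (auto simp: indep_def intro: exI[of _ "{}"])
      ultimately have "(\<Sum>I\<in>?I. 2 * \<Delta> * card I) < (\<Sum>I\<in>?I. m * card A)"
        using fin by (intro sum_strict_mono) auto
      with total show False by (simp add: mult.commute mult.left_commute)
    qed
  qed
qed

subsection \<open>Sampling a bipartite induced subgraph\<close>

text \<open>The probability of sampling all of \<open>T\<close> and none of \<open>W\<close> at rate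
  \<open>1 / Suc q\<close>, with denominators cleared so that the identity stays in the natural
  numbers.\<close>

lemma card_functions_prescribed_zeros:
  fixes U :: "'a set" and q :: nat
  assumes "finite U" "T \<subseteq> U" "W \<subseteq> U" "T \<inter> W = {}"
  shows "card {f \<in> U \<rightarrow>\<^sub>E {..<Suc q}. (\<forall>t\<in>T. f t = 0) \<and> (\<forall>w\<in>W. f w \<noteq> 0)} * Suc q ^ (card T + card W)
    = q ^ card W * Suc q ^ card U"
proof -
  define F where "F v = (if v \<in> T then {0} else if v \<in> W then {1..<Suc q} else {..<Suc q})" for v
  have eq: "{f \<in> U \<rightarrow>\<^sub>E {..<Suc q}. (\<forall>t\<in>T. f t = 0) \<and> (\<forall>w\<in>W. f w \<noteq> 0)} = Pi\<^sub>E U F"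
  proof (intro equalityI subsetI)
    fix f assume "f \<in> {f \<in> U \<rightarrow>\<^sub>E {..<Suc q}. (\<forall>t\<in>T. f t = 0) \<and> (\<forall>w\<in>W. f w \<noteq> 0)}"
    then have f: "f \<in> U \<rightarrow>\<^sub>E {..<Suc q}" "\<And>t. t \<in> T \<Longrightarrow> f t = 0" "\<And>w. w \<in> W \<Longrightarrow> f w \<noteq> 0"
      by auto
    show "f \<in> Pi\<^sub>E U F"
    proof (rule PiE_I)
      fix x assume "x \<in> U"
      then have "f x < Suc q" using f(1) by (auto simp: PiE_iff)
      with f(2,3)[of x] show "f x \<in> F x" by (auto simp: F_def)
    next
      fix x assume "x \<notin> U"
      then show "f x = undefined" using f(1) by (auto simp: PiE_iff extensional_def)
    qed
  next
    fix f assume f: "f \<in> Pi\<^sub>E U F"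
    have Ff: "f x \<in> F x" if "x \<in> U" for x using f that by (auto simp: PiE_iff)
    have "f \<in> U \<rightarrow>\<^sub>E {..<Suc q}"
    proof (rule PiE_I)
      fix x assume "x \<in> U"
      with Ff[of x] show "f x \<in> {..<Suc q}" by (auto simp: F_def split: if_splits)
    next
      fix x assume "x \<notin> U"
      then show "f x = undefined" using f by (auto simp: PiE_iff extensional_def)
    qed
    moreover have "f t = 0" if "t \<in> T" for t
      using Ff[of t] that assms by (auto simp: F_def)
    moreover have "f w \<noteq> 0" if "w \<in> W" for w
    proof -
      have "w \<in> U" "w \<notin> T" using that assms by blast+
      with Ff[of w] that show ?thesis by (simp add: F_def)
    qed
    ultimately show "f \<in> {f \<in> U \<rightarrow>\<^sub>E {..<Suc q}. (\<forall>t\<in>T. f t = 0) \<and> (\<forall>w\<in>W. f w \<noteq> 0)}" by blast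
  qed
  have fin: "finite T" "finite W" using assms finite_subset by blast+
  have U: "U = (T \<union> W) \<union> (U - (T \<union> W))" using assms by blast
  have "card (Pi\<^sub>E U F) = (\<Prod>v\<in>U. card (F v))" using assms(1) by (rule card_PiE)
  also have "\<dots> = (\<Prod>v\<in>(T \<union> W) \<union> (U - (T \<union> W)). card (F v))" using U by simp
  also have "\<dots> = (\<Prod>v\<in>T \<union> W. card (F v)) * (\<Prod>v\<in>U - (T \<union> W). card (F v))"
    using fin assms(1) by (intro prod.union_disjoint) auto
  also have "(\<Prod>v\<in>T \<union> W. card (F v)) = (\<Prod>v\<in>T. card (F v)) * (\<Prod>v\<in>W. card (F v))"
    using fin assms(4) by (intro prod.union_disjoint) auto
  also have "(\<Prod>v\<in>T. card (F v)) = 1" by (simp add: F_def)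
  also have "(\<Prod>v\<in>W. card (F v)) = (\<Prod>v\<in>W. q)"
    using assms(4) by (intro prod.cong) (auto simp: F_def)
  also have "(\<Prod>v\<in>U - (T \<union> W). card (F v)) = (\<Prod>v\<in>U - (T \<union> W). Suc q)"
    by (intro prod.cong) (auto simp: F_def)
  finally have "card (Pi\<^sub>E U F) = q ^ card W * Suc q ^ card (U - (T \<union> W))" by simp
  moreover have "card U = card (U - (T \<union> W)) + (card T + card W)"
  proof -
    have "card U = card ((T \<union> W) \<union> (U - (T \<union> W)))" using U by simp
    also have "\<dots> = card (T \<union> W) + card (U - (T \<union> W))"
      using fin assms(1) by (intro card_Un_disjoint) auto
    also have "card (T \<union> W) = card T + card W"
      using fin assms(4) by (rule card_Un_disjoint)
    finally show ?thesis by simp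
  qed
  ultimately show ?thesis
    unfolding eq by (simp only: power_add mult.assoc)
qed

text \<open>By Bernoulli's inequality, \<open>(1 - 1 / Suc q) ^ n\<close> is at least
  \<open>1 - n / Suc q\<close>, hence at least one half.\<close>

lemma power_pred_ge_half:
  fixes q n :: nat
  assumes "2 * n \<le> Suc q"
  shows "Suc q ^ n \<le> 2 * q ^ n"
proof -
  define x where "x = - 1 / real (Suc q)"
  have "1 + real n * x \<le> (1 + x) ^ n"
    by (rule Bernoulli_inequality) (simp add: x_def field_simps)
  moreover have "1 + x = real q / real (Suc q)"
    by (simp add: x_def field_simps)
  moreover have "1 / 2 \<le> 1 + real n * x"
    using assms by (simp add: x_def field_simps)
  ultimately have "1 / 2 \<le> real q ^ n / real (Suc q) ^ n"
    by (simp only: power_divide[symmetric])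
  then have "real (Suc q) ^ n \<le> 2 * real q ^ n"
    by (simp add: field_simps del: of_nat_Suc)
  then have "real (Suc q ^ n) \<le> real (2 * q ^ n)" by simp
  then show ?thesis by (simp only: of_nat_le_iff)
qed

text \<open>Avoiding at most \<open>q / 2\<close> vertices costs only a factor 2, so the event has
  probability at least \<open>1 / (2 * q ^ card T)\<close>.\<close>

lemma card_functions_prescribed_zeros_ge:
  fixes U :: "'a set" and q :: nat
  assumes "finite U" "T \<subseteq> U" "W \<subseteq> U" "T \<inter> W = {}" "2 * card W \<le> q"  "q > 0"
  shows "q ^ card U \<le> 2 * q ^ card T * card {f \<in> U \<rightarrow>\<^sub>E {..<q}. (\<forall>t\<in>T. f t = 0) \<and> (\<forall>w\<in>W. f w \<noteq> 0)}"
proof -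
  obtain q' where q: "q = Suc q'" using assms(6) gr0_implies_Suc by blast
  define N where "N = card {f \<in> U \<rightarrow>\<^sub>E {..<Suc q'}. (\<forall>t\<in>T. f t = 0) \<and> (\<forall>w\<in>W. f w \<noteq> 0)}"
  have "Suc q' ^ card W * Suc q' ^ card U \<le> 2 * q' ^ card W * Suc q' ^ card U"
    using power_pred_ge_half[of "card W" q'] assms(5) by (intro mult_le_mono1) (simp add: q)
  also have "\<dots> = 2 * (N * Suc q' ^ (card T + card W))"
    unfolding N_def card_functions_prescribed_zeros[OF assms(1-4)] by simp
  also have "\<dots> = Suc q' ^ card W * (2 * Suc q' ^ card T * N)"
    by (simp only: power_add ac_simps)
  finally have "Suc q' ^ card U \<le> 2 * Suc q' ^ card T * N"
    by (simp del: power_Suc)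
  then show ?thesis by (simp only: q N_def)
qed

text \<open>
  The set \<open>B\<close> consists of the sampled vertices without an earlier sampled neighbour. Working with
  earlier neighbours only matters: the full degree of a sampled vertex is not bounded in terms
  of \<open>D\<close>, but the events below must depend on \<open>O(D)\<close> vertices. Each vertex of \<open>V - I\<close> is sampled
  with probability \<open>1 / q\<close>, modelled by a uniform function into \<open>{..<q}\<close> taking the value \<open>0\<close>.
\<close>

lemma sample_independent_side:
  fixes V I :: "'a set" and p :: real and D r q :: nat and ord :: "'a \<Rightarrow> nat"
  assumes fin: "finite V" and I: "I \<subseteq> V" "indep I E"
    and ord: "inj_on ord V" "\<And>v. v \<in> V \<Longrightarrow> card {u \<in> nbrs E V v. ord u < ord v} \<le> D"
    and deg: "\<And>a. a \<in> I \<Longrightarrow> card (nbrs E V a) \<le> 4 * D"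
    and \<T>: "\<And>a T. a \<in> I \<Longrightarrow> T \<in> \<T> a \<Longrightarrow> T \<subseteq> nbrs E V a \<and> card T = r \<and> indep T E"
    and p: "\<And>a. a \<in> I \<Longrightarrow> p \<le> real (card (\<T> a))"
    and q: "q = 2 * (4 + r) * D" "D > 0"
    and large: "real (card V) * 2 * real q ^ r < real (card I) * p * real q"
  shows "\<exists>A B. A \<subseteq> I \<and> B \<subseteq> V - I \<and> indep B E \<and> card B < card A \<and> (\<forall>a\<in>A. nbrs E B a \<in> \<T> a)"
proof -
  define U where "U = V - I"
  define F where "F = (U \<rightarrow>\<^sub>E {..<q})"
  define Z where "Z f = {v \<in> U. f v = 0}" for f :: "'a \<Rightarrow> nat"
  define B where "B f = {v \<in> Z f. \<forall>u\<in>nbrs E (Z f) v. \<not> ord u < ord v}" for f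
  define A where "A f = {a \<in> I. nbrs E (B f) a \<in> \<T> a}" for f
  have finU: "finite U" and finI: "finite I" using fin I finite_subset by (auto simp: U_def)
  have q0: "q > 0" using q by simp
  have finF: "finite F" using finU by (auto simp: F_def intro: finite_PiE)
  have BZ: "B f \<subseteq> Z f" "Z f \<subseteq> U" for f by (auto simp: B_def Z_def)
  have indepB: "indep (B f) E" for f
    unfolding indep_def
  proof (intro ballI impI notI)
    fix u v assume uv: "u \<in> B f" "v \<in> B f" "u \<noteq> v" "{u, v} \<in> E"
    then have "ord u \<noteq> ord v"
      using inj_onD[OF ord(1), of u v] BZ[of f] by (auto simp: U_def)
    moreover have "u \<in> nbrs E (Z f) v" "v \<in> nbrs E (Z f) u"
      using uv BZ[of f] by (auto simp: nbrs_def insert_commute)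
    moreover have "\<not> ord u < ord v" "\<not> ord v < ord u"
      using calculation(2,3) uv(1,2) by (auto simp: B_def)
    ultimately show False by linarith
  qed
  \<comment> \<open>The expected number of sampled vertices is \<open>card U / q\<close>.\<close>
  have sumZ: "(\<Sum>f\<in>F. card (Z f)) * q = card U * q ^ card U"
  proof -
    have "card {f \<in> F. f v = 0} * q = q ^ card U" if "v \<in> U" for v
    proof -
      obtain q' where q': "q = Suc q'" using q0 gr0_implies_Suc by blast
      show ?thesis
        using card_functions_prescribed_zeros[OF finU, of "{v}" "{}" q'] that
        by (simp add: F_def q' del: power_Suc)
    qed
    moreover have "(\<Sum>f\<in>F. card (Z f)) = (\<Sum>v\<in>U. card {f \<in> F. f v = 0})"
      unfolding Z_def by (rule sum_multicount_gen[OF finF finU]) simp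
    ultimately show ?thesis by (simp add: sum_distrib_right)
  qed
  have good: "p * real (q ^ card U) \<le> 2 * real q ^ r * real (card {f \<in> F. nbrs E (B f) a \<in> \<T> a})"
    if a: "a \<in> I" for a
  proof -
    \<comment> \<open>If \<open>T\<close> is sampled and \<open>W T\<close> is not, the
      neighbourhood of \<open>a\<close> in \<open>B f\<close> is exactly \<open>T\<close>: no other
      neighbour of \<open>a\<close> is sampled, and no earlier neighbour evicts a member of
      \<open>T\<close>. The bound \<open>card (W T) \<le> (4 + r) * D\<close> is what dictates the
      value of \<open>q\<close>.\<close>
    define W where "W T = (nbrs E U a \<union> (\<Union>t\<in>T. {u \<in> nbrs E U t. ord u < ord t})) - T" for T
    define G where "G T = {f \<in> F. (\<forall>t\<in>T. f t = 0) \<and> (\<forall>w\<in>W T. f w \<noteq> 0)}" for T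
    have nUV: "nbrs E V a = nbrs E U a"
      using I a by (auto simp: nbrs_def U_def indep_def)
    have T: "T \<subseteq> nbrs E U a" "T \<subseteq> U" "finite T" "card T = r" "indep T E" if "T \<in> \<T> a" for T
      using \<T>[OF a that] nUV nbrs_subset[of E U a] finU finite_subset[of T U] by auto
    have finT: "finite (\<T> a)"
      using T(2) finU by (intro finite_subset[of "\<T> a" "Pow U"]) auto
    have cardG: "q ^ card U \<le> 2 * q ^ r * card (G T)" if "T \<in> \<T> a" for T
    proof -
      have "card (W T) \<le> card (nbrs E U a \<union> (\<Union>t\<in>T. {u \<in> nbrs E U t. ord u < ord t}))"
        using finU T(3)[OF that] unfolding W_def by (intro card_mono) auto
      also have "\<dots> \<le> card (nbrs E U a) + card (\<Union>t\<in>T. {u \<in> nbrs E U t. ord u < ord t})"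
        by (rule card_Un_le)
      also have "\<dots> \<le> 4 * D + (\<Sum>t\<in>T. card {u \<in> nbrs E U t. ord u < ord t})"
        using deg[OF a] nUV card_UN_le[OF T(3)[OF that]] by (intro add_mono) auto
      also have "\<dots> \<le> 4 * D + (\<Sum>t\<in>T. D)"
      proof (intro add_left_mono sum_mono)
        fix t assume "t \<in> T"
        then have "t \<in> V" using T(2)[OF that] by (auto simp: U_def)
        have "card {u \<in> nbrs E U t. ord u < ord t} \<le> card {u \<in> nbrs E V t. ord u < ord t}"
          using fin by (intro card_mono) (auto simp: nbrs_def U_def)
        also have "\<dots> \<le> D" using ord(2) \<open>t \<in> V\<close> by simp
        finally show "card {u \<in> nbrs E U t. ord u < ord t} \<le> D" .
      qed
      also have "\<dots> = (4 + r) * D" using T(4)[OF that] by (simp add: algebra_simps)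
      finally have "2 * card (W T) \<le> q"
        unfolding q(1) mult.assoc by (rule mult_le_mono2)
      moreover have "W T \<subseteq> U" by (auto simp: W_def nbrs_def)
      moreover have "T \<inter> W T = {}" by (auto simp: W_def)
      ultimately show ?thesis
        using card_functions_prescribed_zeros_ge[OF finU T(2)[OF that], of "W T" q] q0 T(4)[OF that]
        by (simp add: G_def F_def)
    qed
    have zeros: "{v \<in> nbrs E U a. f v = 0} = T" if "T \<in> \<T> a" "f \<in> G T" for T f
    proof (intro equalityI subsetI)
      fix v assume v: "v \<in> {v \<in> nbrs E U a. f v = 0}"
      show "v \<in> T"
      proof (rule ccontr)
        assume "v \<notin> T"
        with v have "v \<in> W T" by (simp add: W_def)
        with v that(2) show False by (auto simp: G_def)
      qed
    qed (use that T(1)[OF that(1)] in \<open>auto simp: G_def\<close>)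
    have sub: "nbrs E (B f) a \<in> \<T> a" if "T \<in> \<T> a" "f \<in> G T" for T f
    proof -
      have "nbrs E (B f) a = T"
      proof (intro equalityI subsetI)
        fix v assume "v \<in> nbrs E (B f) a"
        then have "v \<in> {v \<in> nbrs E U a. f v = 0}" using BZ[of f] by (auto simp: nbrs_def Z_def)
        then show "v \<in> T" using zeros[OF that] by simp
      next
        fix v assume v: "v \<in> T"
        have "v \<in> Z f" using v zeros[OF that] T(2)[OF that(1)] by (auto simp: Z_def)
        moreover have "\<not> ord u < ord v" if u: "u \<in> nbrs E (Z f) v" for u
        proof
          assume less: "ord u < ord v"
          \<comment> \<open>Independence of \<open>T\<close> prevents its members from evicting one
            another.\<close>
          have "u \<notin> T" using u v T(5)[OF \<open>T \<in> \<T> a\<close>] by (auto simp: nbrs_def indep_def)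
          moreover have "u \<in> nbrs E U v" using u BZ[of f] by (auto simp: nbrs_def)
          ultimately have "u \<in> W T" using less v by (auto simp: W_def)
          then show False using u \<open>f \<in> G T\<close> by (auto simp: G_def nbrs_def Z_def)
        qed
        ultimately have "v \<in> B f" by (auto simp: B_def)
        then show "v \<in> nbrs E (B f) a" using v T(1)[OF that(1)] by (auto simp: nbrs_def)
      qed
      then show ?thesis using that(1) by simp
    qed
    have "p * real (q ^ card U) \<le> real (card (\<T> a)) * real (q ^ card U)"
      using p[OF a] by (intro mult_right_mono) auto
    also have "\<dots> = real (\<Sum>T\<in>\<T> a. q ^ card U)" by simp
    also have "\<dots> \<le> real (\<Sum>T\<in>\<T> a. 2 * q ^ r * card (G T))"
      using cardG by (intro of_nat_mono sum_mono) auto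
    also have "(\<Sum>T\<in>\<T> a. 2 * q ^ r * card (G T)) = 2 * q ^ r * (\<Sum>T\<in>\<T> a. card (G T))"
      by (simp add: sum_distrib_left)
    \<comment> \<open>The events are disjoint, since \<open>T\<close> is recovered from
      \<open>f\<close> as the set of sampled neighbours of \<open>a\<close>; their probabilities
      therefore add up.\<close>
    also have "(\<Sum>T\<in>\<T> a. card (G T)) = card (\<Union>T\<in>\<T> a. G T)"
    proof (rule card_UN_disjoint[symmetric, OF finT])
      show "\<forall>T\<in>\<T> a. finite (G T)" using finF by (auto simp: G_def)
      show "\<forall>S\<in>\<T> a. \<forall>T\<in>\<T> a. S \<noteq> T \<longrightarrow> G S \<inter> G T = {}" using zeros by blast
    qed
    also have "real (2 * q ^ r * card (\<Union>T\<in>\<T> a. G T)) \<le> real (2 * q ^ r * card {f \<in> F. nbrs E (B f) a \<in> \<T> a})"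
    proof (intro of_nat_mono mult_le_mono2 card_mono)
      show "(\<Union>T\<in>\<T> a. G T) \<subseteq> {f \<in> F. nbrs E (B f) a \<in> \<T> a}"
        using sub by (auto simp: G_def)
    qed (use finF in auto)
    finally show ?thesis by simp
  qed
  \<comment> \<open>First moment: on average \<open>A f\<close> has at least
    \<open>card I * p / (2 * q ^ r)\<close> elements and \<open>B f\<close> at most
    \<open>card V / q\<close>; the hypothesis \<open>large\<close> says that the former is
    bigger.\<close>
  have "\<exists>f\<in>F. card (B f) < card (A f)"
  proof (rule ccontr)
    assume "\<not> ?thesis"
    then have le: "card (A f) \<le> card (B f)" if "f \<in> F" for f
      using that by (auto simp: not_less)
    have "(\<Sum>a\<in>I. card {f \<in> F. nbrs E (B f) a \<in> \<T> a}) = (\<Sum>f\<in>F. card (A f))"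
      unfolding A_def by (rule sum_multicount_gen[symmetric, OF finF finI]) simp
    also have "\<dots> \<le> (\<Sum>f\<in>F. card (Z f))"
    proof (rule sum_mono)
      fix f assume "f \<in> F"
      have "card (B f) \<le> card (Z f)"
        using BZ[of f] finU finite_subset by (intro card_mono) auto
      with le[OF \<open>f \<in> F\<close>] show "card (A f) \<le> card (Z f)" by simp
    qed
    finally have AZ: "(\<Sum>a\<in>I. card {f \<in> F. nbrs E (B f) a \<in> \<T> a}) \<le> (\<Sum>f\<in>F. card (Z f))" .
    have "real (card I) * p * real q * real (q ^ card U) = (\<Sum>a\<in>I. p * real (q ^ card U)) * real q"
      by simp
    also have "\<dots> \<le> (\<Sum>a\<in>I. 2 * real q ^ r * real (card {f \<in> F. nbrs E (B f) a \<in> \<T> a})) * real q"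
      using good by (intro mult_right_mono sum_mono) auto
    also have "\<dots> = 2 * real q ^ r * real ((\<Sum>a\<in>I. card {f \<in> F. nbrs E (B f) a \<in> \<T> a}) * q)"
      by (simp add: sum_distrib_left mult.assoc)
    also have "\<dots> \<le> 2 * real q ^ r * real ((\<Sum>f\<in>F. card (Z f)) * q)"
      using AZ by (intro mult_left_mono of_nat_mono mult_le_mono1) auto
    also have "\<dots> = 2 * real q ^ r * real (card U) * real (q ^ card U)"
      unfolding sumZ by simp
    also have "\<dots> \<le> 2 * real q ^ r * real (card V) * real (q ^ card U)"
      using fin by (intro mult_right_mono mult_left_mono of_nat_mono card_mono) (auto simp: U_def)
    finally have "real (card I) * p * real q \<le> 2 * real q ^ r * real (card V)"
      using q0 by simp
    with large show False by (simp add: mult.commute mult.left_commute)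
  qed
  then obtain f where "card (B f) < card (A f)" by blast
  moreover have "A f \<subseteq> I" "B f \<subseteq> V - I" using BZ[of f] by (auto simp: A_def U_def)
  ultimately show ?thesis using indepB[of f] by (intro exI[of _ "A f"] exI[of _ "B f"]) (auto simp: A_def)
qed

section \<open>Choosing a colour and the parameters of the sample\<close>

lemma colour_pigeonhole:
  fixes g :: "'a \<Rightarrow> nat"
  assumes "finite X" "g \<in> X \<rightarrow> {1..k}" "k \<ge> 1"
  shows "\<exists>c. card X \<le> k * card {x \<in> X. g x = c}"
proof (rule ccontr)
  assume "\<not> ?thesis"
  then have less: "k * card {x \<in> X. g x = c} < card X" for c by (simp add: not_le)
  have "X = (\<Union>c\<in>{1..k}. {x \<in> X. g x = c})" using assms(2) by auto
  then have "card X \<le> (\<Sum>c\<in>{1..k}. card {x \<in> X. g x = c})"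
    using card_UN_le[of "{1..k}" "\<lambda>c. {x \<in> X. g x = c}"] by simp
  then have "k * card X \<le> (\<Sum>c\<in>{1..k}. k * card {x \<in> X. g x = c})"
    by (simp add: sum_distrib_left[symmetric])
  also have "\<dots> < (\<Sum>c\<in>{1..k}. card X)"
    using assms(3) less by (intro sum_strict_mono) auto
  finally show False by simp
qed

text \<open>Markov's inequality: the average degree is at most \<open>2 * D\<close>.\<close>

lemma half_low_degree:
  assumes "finite V" "degenerate E V D" "D > 0"
  shows "card V \<le> 2 * card {v \<in> V. card (nbrs E V v) \<le> 4 * D}"
proof -
  let ?lo = "{v \<in> V. card (nbrs E V v) \<le> 4 * D}" and ?hi = "{v \<in> V. \<not> card (nbrs E V v) \<le> 4 * D}"
  have "4 * D * card ?hi = (\<Sum>v\<in>?hi. 4 * D)" by simp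
  also have "\<dots> \<le> (\<Sum>v\<in>?hi. card (nbrs E V v))" by (intro sum_mono) auto
  also have "\<dots> \<le> (\<Sum>v\<in>V. card (nbrs E V v))" using assms(1) by (intro sum_mono2) auto
  also have "\<dots> \<le> 2 * D * card V" using assms(1,2) by (rule degenerate_sum_degrees_le)
  finally have "(2 * D) * (2 * card ?hi) \<le> (2 * D) * card V" by simp
  then have "2 * card ?hi \<le> card V" using assms(3) by simp
  moreover have "card V = card ?lo + card ?hi"
  proof -
    have "card V = card (?lo \<union> ?hi)" by (intro arg_cong[where f = card]) auto
    also have "\<dots> = card ?lo + card ?hi" using assms(1) by (intro card_Un_disjoint) auto
    finally show ?thesis .
  qed
  ultimately show ?thesis by linarith
qed

text \<open>Minimum degree \<open>D\<close> gives each vertex of order \<open>D ^ r\<close>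
  independent \<open>r\<close>-sets in its majority colour, while sampling at rate of order
  \<open>1 / D\<close> hits a given one with probability of order \<open>D ^ (-r)\<close>. These
  powers cancel, so only \<open>card I * D / card V\<close> has to exceed a constant, which the free
  factor \<open>f\<close> achieves.\<close>

lemma monochromatic_dense_pair:
  fixes k r t :: nat
  assumes k: "k \<ge> 1" and r: "r \<ge> 1"
  shows "\<exists>D0. \<forall>D\<ge>D0. \<forall>(V :: 'a set) E \<phi>.
    finite V \<and> V \<noteq> {} \<and> \<not> (\<exists>K\<subseteq>V. card K = t \<and> clique K E) \<and> degenerate E V D \<and>
    (\<forall>v\<in>V. D \<le> card (nbrs E V v) \<and> (\<forall>u\<in>nbrs E V v. \<phi> {u, v} \<in> {1..k})) \<longrightarrow>
    (\<exists>A B c. A \<subseteq> V \<and> B \<subseteq> V \<and> A \<inter> B = {} \<and> indep A E \<and> indep B E \<and> card B < card A \<and>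
      (\<forall>a\<in>A. card (nbrs E B a) = r \<and> (\<forall>u\<in>nbrs E B a. \<phi> {u, a} = c)))"
proof -
  obtain R where R: "\<And>(Y :: 'a set) E. finite Y \<Longrightarrow> R \<le> card Y \<Longrightarrow>
      \<not> (\<exists>K\<subseteq>Y. card K = t \<and> clique K E) \<Longrightarrow>
      card Y choose r \<le> (R choose r) * card {S. S \<subseteq> Y \<and> card S = r \<and> indep S E}"
    using clique_free_many_independent_sets[of t r] by blast
  \<comment> \<open>The \<open>Suc\<close> keeps \<open>C\<close> positive even if
    \<open>R < r\<close>.\<close>
  define C where "C = Suc (R choose r)"
  \<comment> \<open>This is the quotient \<open>q ^ r / p\<close> for the \<open>p\<close> and
    \<open>q\<close> defined below, with the powers of \<open>D\<close> cancelled; hence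
    \<open>f\<close> and \<open>\<Delta>0\<close> do not depend on \<open>D\<close>.\<close>
  define X where "X = (2 * (4 + r)) ^ r * ((k * r) ^ r * C)"
  \<comment> \<open>The factor \<open>k\<close> pays for restricting to one majority colour, and the
    \<open>+ 1\<close> makes the final inequality strict.\<close>
  define f where "f = k * (2 * X + 1)"
  obtain \<Delta>0 where \<Delta>0: "\<And>\<Delta> (A :: 'a set) E. \<Delta>0 \<le> \<Delta> \<Longrightarrow> finite A \<Longrightarrow>
      \<not> (\<exists>K\<subseteq>A. card K = t \<and> clique K E) \<Longrightarrow> (\<And>v. v \<in> A \<Longrightarrow> card (nbrs E A v) \<le> \<Delta>) \<Longrightarrow>
      \<exists>I\<subseteq>A. indep I E \<and> f * card A \<le> \<Delta> * card I"
    using large_independent_set[of t f] by metis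
  show ?thesis
  \<comment> \<open>The term with \<open>k\<close> forces majority-colour neighbourhoods, of size at
    least \<open>D / k\<close>, to have at least \<open>R\<close> and at least \<open>r\<close>
    vertices; \<open>Suc\<close> makes \<open>D\<close> positive.\<close>
  proof (intro exI[of _ "Suc (\<Delta>0 + k * (R + r))"] allI impI)
    fix D and V :: "'a set" and E and \<phi> :: "'a set \<Rightarrow> nat"
    assume D: "Suc (\<Delta>0 + k * (R + r)) \<le> D"
      and asm: "finite V \<and> V \<noteq> {} \<and> \<not> (\<exists>K\<subseteq>V. card K = t \<and> clique K E) \<and> degenerate E V D \<and>
        (\<forall>v\<in>V. D \<le> card (nbrs E V v) \<and> (\<forall>u\<in>nbrs E V v. \<phi> {u, v} \<in> {1..k}))"
    from asm have fin: "finite V" and noK: "\<And>K. K \<subseteq> V \<Longrightarrow> \<not> (card K = t \<and> clique K E)"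
      and dgn: "degenerate E V D" and mindeg: "\<And>v. v \<in> V \<Longrightarrow> D \<le> card (nbrs E V v)"
      and col: "\<And>v u. v \<in> V \<Longrightarrow> u \<in> nbrs E V v \<Longrightarrow> \<phi> {u, v} \<in> {1..k}" by auto
    have D0: "D > 0" using D by simp
    obtain ord :: "'a \<Rightarrow> nat" where ord: "inj_on ord V"
      "\<And>v. v \<in> V \<Longrightarrow> card {u \<in> nbrs E V v. ord u < ord v} \<le> D"
      using degenerate_ordering[OF fin dgn] by blast
    define A0 where "A0 = {v \<in> V. card (nbrs E V v) \<le> 4 * D}"
    define M where "M c a = {u \<in> nbrs E V a. \<phi> {u, a} = c}" for c a
    have "\<exists>c. D \<le> k * card (M c a) \<and> c \<in> {1..k}" if "a \<in> V" for a
    proof -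
      have "(\<lambda>u. \<phi> {u, a}) \<in> nbrs E V a \<rightarrow> {1..k}" using col[OF that] by blast
      then obtain c where c: "card (nbrs E V a) \<le> k * card (M c a)"
        using colour_pigeonhole[of "nbrs E V a" "\<lambda>u. \<phi> {u, a}" k] finite_nbrs[OF fin] k
        unfolding M_def by blast
      then have *: "D \<le> k * card (M c a)" using mindeg[OF that] by linarith
      \<comment> \<open>The pigeonhole does not place \<open>c\<close> in \<open>{1..k}\<close>. A
        nonempty colour class does, as needed for the second pigeonhole over
        \<open>h\<close>.\<close>
      then have "M c a \<noteq> {}" using D0 by auto
      then have "c \<in> {1..k}" using col[OF that] by (auto simp: M_def)
      with * show ?thesis by blast
    qed
    then obtain h where h: "\<And>a. a \<in> V \<Longrightarrow> D \<le> k * card (M (h a) a)" "\<And>a. a \<in> V \<Longrightarrow> h a \<in> {1..k}"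
      by metis
    obtain c where c: "card A0 \<le> k * card {a \<in> A0. h a = c}"
      using colour_pigeonhole[of A0 h k] fin h(2) k by (auto simp: A0_def)
    define Ac where "Ac = {a \<in> A0. h a = c}"
    have AcV: "Ac \<subseteq> V" and finAc: "finite Ac" using fin by (auto simp: Ac_def A0_def)
    have deg: "card (nbrs E V a) \<le> 4 * D" if "a \<in> Ac" for a using that by (simp add: Ac_def A0_def)
    have "\<exists>I\<subseteq>Ac. indep I E \<and> f * card Ac \<le> 4 * D * card I"
    proof (rule \<Delta>0)
      show "\<Delta>0 \<le> 4 * D" using D by simp
      show "\<not> (\<exists>K\<subseteq>Ac. card K = t \<and> clique K E)" using noK AcV by blast
      fix v assume v: "v \<in> Ac"
      have "card (nbrs E Ac v) \<le> card (nbrs E V v)"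
        using fin AcV by (intro card_mono) (auto simp: nbrs_def)
      with deg[OF v] show "card (nbrs E Ac v) \<le> 4 * D" by linarith
    qed (rule finAc)
    then obtain I where I: "I \<subseteq> Ac" "indep I E" "f * card Ac \<le> 4 * D * card I" by blast
    define \<T> where "\<T> a = {T. T \<subseteq> M c a \<and> card T = r \<and> indep T E}" for a
    \<comment> \<open>With \<open>m \<ge> D / k\<close> coloured neighbours,
      \<open>m choose r\<close> is at least \<open>(m / r) ^ r\<close>; a proportion of at least
      \<open>1 / C\<close> of these \<open>r\<close>-sets is independent.\<close>
    define p where "p = real D ^ r / real ((k * r) ^ r * C)"
    define q where "q = 2 * (4 + r) * D"
    have C: "C > 0" by (simp add: C_def)
    have krC: "(k * r) ^ r * C > 0" using k r by (simp add: C_def)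
    have p: "p \<le> real (card (\<T> a))" if "a \<in> I" for a
    proof -
      have a: "a \<in> V" "h a = c" using that I AcV by (auto simp: Ac_def)
      define m where "m = card (M c a)"
      have Dm: "D \<le> k * m" using h(1)[OF a(1)] a(2) by (simp add: m_def)
      with D have "k * (R + r) \<le> k * m" by linarith
      then have m: "R \<le> m" "r \<le> m" using k by auto
      have MV: "M c a \<subseteq> V" "finite (M c a)" using fin by (auto simp: M_def nbrs_def)
      have "m choose r \<le> (R choose r) * card (\<T> a)"
        unfolding m_def \<T>_def using noK MV m(1) by (intro R) (auto simp: m_def)
      also have "\<dots> \<le> C * card (\<T> a)" by (simp add: C_def)
      finally have count: "m choose r \<le> C * card (\<T> a)" .
      have "(real D / real (k * r)) ^ r \<le> (real m / real r) ^ r"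
      proof (rule power_mono)
        have "real D \<le> real k * real m" using Dm by (metis of_nat_mono of_nat_mult)
        then show "real D / real (k * r) \<le> real m / real r"
          using k r by (simp add: field_simps)
      qed simp
      also have "\<dots> \<le> real (m choose r)" using m(2) by (rule binomial_ge_n_over_k_pow_k)
      also have "\<dots> \<le> real (C * card (\<T> a))" using count by (rule of_nat_mono)
      finally have "(real D / real (k * r)) ^ r \<le> real C * real (card (\<T> a))" by simp
      moreover have "(real D / real (k * r)) ^ r = p * real C"
        using C by (simp add: p_def power_divide)
      ultimately show ?thesis using C by (simp add: mult.commute)
    qed
    have "card V * (2 * X + 1) \<le> card I * q"
    proof -
      have "k * (card V * (2 * X + 1)) = f * card V" by (simp add: f_def algebra_simps)
      also have "\<dots> \<le> f * (2 * (k * card Ac))"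
      proof (rule mult_le_mono2)
        have "card V \<le> 2 * card A0" unfolding A0_def using fin dgn D0 by (rule half_low_degree)
        with c show "card V \<le> 2 * (k * card Ac)" by (simp add: Ac_def)
      qed
      also have "\<dots> = 2 * k * (f * card Ac)" by simp
      also have "\<dots> \<le> 2 * k * (4 * D * card I)" using I(3) by (rule mult_le_mono2)
      also have "\<dots> = k * (card I * (8 * D))" by simp
      also have "\<dots> \<le> k * (card I * q)"
        unfolding q_def by (intro mult_le_mono2 mult_le_mono1) simp
      finally show ?thesis using k by simp
    qed
    moreover have "card V > 0" using asm by (simp add: card_gt_0_iff)
    ultimately have less: "card V * (2 * X) < card I * q" by simp
    have p0: "p > 0" unfolding p_def using krC D0 by (intro divide_pos_pos) auto
    have "real ((k * r) ^ r * C) \<noteq> 0" using krC by linarith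
    then have "real ((k * r) ^ r * C) * p = real D ^ r"
      unfolding p_def times_divide_eq_right by (rule nonzero_mult_div_cancel_left)
    then have Xp: "real X * p = real (2 * (4 + r)) ^ r * real D ^ r"
      unfolding X_def of_nat_mult[of "(2 * (4 + r)) ^ r"] of_nat_power[of "2 * (4 + r)"] mult.assoc[of _ _ p]
      by (rule arg_cong)
    have "real (card V) * 2 * real q ^ r = real (card V * (2 * X)) * p"
    proof -
      have "real q ^ r = real X * p" unfolding Xp q_def of_nat_mult[of _ D] by (rule power_mult_distrib)
      then show ?thesis by simp
    qed
    also have "\<dots> < real (card I * q) * p"
      using less p0 by (intro mult_strict_right_mono) (auto simp del: of_nat_mult)
    finally have large: "real (card V) * 2 * real q ^ r < real (card I) * p * real q"
      by (simp add: mult.commute mult.left_commute)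
    have "\<exists>A B. A \<subseteq> I \<and> B \<subseteq> V - I \<and> indep B E \<and> card B < card A \<and> (\<forall>a\<in>A. nbrs E B a \<in> \<T> a)"
    proof (rule sample_independent_side[OF fin _ I(2) ord _ _ p q_def D0 large])
      show "I \<subseteq> V" using I AcV by blast
      show "card (nbrs E V a) \<le> 4 * D" if "a \<in> I" for a using that I deg by blast
      show "T \<subseteq> nbrs E V a \<and> card T = r \<and> indep T E" if "T \<in> \<T> a" for a T
        using that by (auto simp: \<T>_def M_def)
    qed
    then obtain A B where AB: "A \<subseteq> I" "B \<subseteq> V - I" "indep B E" "card B < card A"
      "\<And>a. a \<in> A \<Longrightarrow> nbrs E B a \<in> \<T> a" by blast
    show "\<exists>A B c. A \<subseteq> V \<and> B \<subseteq> V \<and> A \<inter> B = {} \<and> indep A E \<and> indep B E \<and> card B < card A \<and>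
      (\<forall>a\<in>A. card (nbrs E B a) = r \<and> (\<forall>u\<in>nbrs E B a. \<phi> {u, a} = c))"
    proof (rule exI[of _ A], rule exI[of _ B], rule exI[of _ c], intro conjI ballI)
      show "A \<subseteq> V" "B \<subseteq> V" "A \<inter> B = {}" using AB I AcV by blast+
      show "indep A E" using I(2) AB(1) by (rule indep_subset)
      show "card (nbrs E B a) = r" if "a \<in> A" for a using AB(5)[OF that] by (simp add: \<T>_def)
      show "\<phi> {u, a} = c" if "a \<in> A" "u \<in> nbrs E B a" for a u
        using AB(5)[OF that(1)] that(2) by (auto simp: \<T>_def M_def)
    qed (use AB in auto)
  qed
qed

subsection \<open>Degree-bounded classes\<close>

lemma degree_eq_card_nbrs:
  assumes "finite_simple_graph H"
  shows "degree H v = card (nbrs (edges H) (verts H) v)"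
proof -
  have "{e \<in> edges H. v \<in> e} = (\<lambda>u. {u, v}) ` nbrs (edges H) (verts H) v"
  proof (intro equalityI subsetI)
    fix e assume e: "e \<in> {e \<in> edges H. v \<in> e}"
    then have "card e = 2" "e \<subseteq> verts H" using assms by (auto simp: finite_simple_graph_def)
    then obtain x y where "e = {x, y}" "x \<noteq> y" by (auto simp: card_2_iff)
    with e have "\<exists>u. e = {u, v} \<and> u \<noteq> v" by (auto simp: insert_commute)
    then obtain u where "e = {u, v}" "u \<noteq> v" by blast
    with e \<open>e \<subseteq> verts H\<close> show "e \<in> (\<lambda>u. {u, v}) ` nbrs (edges H) (verts H) v"
      by (auto simp: nbrs_def)
  qed (auto simp: nbrs_def)
  moreover have "inj_on (\<lambda>u. {u, v}) (nbrs (edges H) (verts H) v)"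
    by (auto simp: inj_on_def doubleton_eq_iff)
  ultimately show ?thesis by (simp add: degree_def card_image)
qed

lemma finite_edges:
  assumes "finite_simple_graph G"
  shows "finite (edges G)"
  using assms by (intro finite_subset[of "edges G" "Pow (verts G)"]) (auto simp: finite_simple_graph_def)

lemma subgraph_induced_subgraph:
  assumes "finite_simple_graph G" "S \<subseteq> verts G"
  shows "subgraph (induced_subgraph G S) G"
  using assms by (auto simp: subgraph_def induced_subgraph_def finite_simple_graph_def intro: finite_subset)

lemma nbrs_induced_subgraph:
  "U \<subseteq> S \<Longrightarrow> nbrs (edges (induced_subgraph G S)) U v = (if v \<in> S then nbrs (edges G) U v else {})"
  by (auto simp: nbrs_def induced_subgraph_def)

text \<open>The \<open>LEAST\<close> is attained, because \<open>card (edges G)\<close> is an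
  admissible bound; it is then applied to induced subgraphs.\<close>

lemma degenerate_degeneracy:
  assumes G: "finite_simple_graph G"
  shows "degenerate (edges G) (verts G) (degeneracy G)"
proof -
  let ?P = "\<lambda>d. \<forall>H. subgraph H G \<and> verts H \<noteq> {} \<longrightarrow> (\<exists>v\<in>verts H. degree H v \<le> d)"
  have "?P (card (edges G))"
  proof (intro allI impI)
    fix H :: "'a graph" assume H: "subgraph H G \<and> verts H \<noteq> {}"
    then obtain v where "v \<in> verts H" by blast
    moreover have "degree H v \<le> card (edges G)"
      unfolding degree_def using finite_edges[OF G] H by (intro card_mono) (auto simp: subgraph_def)
    ultimately show "\<exists>v\<in>verts H. degree H v \<le> card (edges G)" by blast
  qed
  then have P: "?P (degeneracy G)" unfolding degeneracy_def by (rule LeastI)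
  show ?thesis
    unfolding degenerate_def
  proof (intro allI impI)
    fix U assume U: "U \<subseteq> verts G" "U \<noteq> {}"
    let ?H = "induced_subgraph G U"
    have H: "subgraph ?H G" "verts ?H = U"
      using subgraph_induced_subgraph[OF G U(1)] by (auto simp: induced_subgraph_def)
    with P U obtain v where "v \<in> U" "degree ?H v \<le> degeneracy G" by metis
    moreover have "degree ?H v = card (nbrs (edges G) U v)"
      using H degree_eq_card_nbrs[of ?H v] nbrs_induced_subgraph[of U U G v] \<open>v \<in> U\<close>
      by (auto simp: subgraph_def)
    ultimately show "\<exists>v\<in>U. card (nbrs (edges G) U v) \<le> degeneracy G" by auto
  qed
qed

text \<open>By minimality \<open>degeneracy G - 1\<close> fails for some subgraph, which thus has
  minimum degree at least \<open>degeneracy G\<close>. Passing to the subgraph induced on its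
  vertices only raises degrees.\<close>

lemma degeneracy_core:
  assumes G: "finite_simple_graph G" and "degeneracy G > 0"
  obtains V where "V \<subseteq> verts G" "V \<noteq> {}" "\<And>v. v \<in> V \<Longrightarrow> degeneracy G \<le> card (nbrs (edges G) V v)"
proof -
  let ?P = "\<lambda>d. \<forall>H. subgraph H G \<and> verts H \<noteq> {} \<longrightarrow> (\<exists>v\<in>verts H. degree H v \<le> d)"
  have "\<not> ?P (degeneracy G - 1)"
    using assms(2) not_less_Least[of "degeneracy G - 1" ?P] unfolding degeneracy_def by simp
  then obtain H where H: "subgraph H G" "verts H \<noteq> {}"
    "\<And>v. v \<in> verts H \<Longrightarrow> \<not> degree H v \<le> degeneracy G - 1" by blast
  have "degeneracy G \<le> card (nbrs (edges G) (verts H) v)" if "v \<in> verts H" for v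
  proof -
    have "degeneracy G \<le> degree H v" using H(3)[OF that] by linarith
    also have "\<dots> = card (nbrs (edges H) (verts H) v)"
      using H(1) by (intro degree_eq_card_nbrs) (simp add: subgraph_def)
    also have "\<dots> \<le> card (nbrs (edges G) (verts H) v)"
      using H(1) by (intro card_mono finite_nbrs)
        (auto simp: subgraph_def finite_simple_graph_def nbrs_def)
    finally show ?thesis .
  qed
  with H show thesis by (intro that[of "verts H"]) (auto simp: subgraph_def)
qed

lemma finite_contains_biclique:
  assumes "finite_simple_graph G"
  shows "finite {s. contains_biclique G s}"
proof (rule finite_subset[of _ "{..card (verts G)}"])
  show "{s. contains_biclique G s} \<subseteq> {..card (verts G)}"
  proof
    fix s assume "s \<in> {s. contains_biclique G s}"
    then obtain A B where "card A = s" "A \<subseteq> verts G"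
      by (auto simp: contains_biclique_def subgraph_def complete_bipartite_def)
    then show "s \<in> {..card (verts G)}"
      using assms card_mono[of "verts G" A] by (auto simp: finite_simple_graph_def)
  qed
qed simp

text \<open>Makes the set under \<open>Max\<close> in \<open>biclique_number\<close>
  nonempty.\<close>

lemma contains_biclique_0: "contains_biclique G 0"
  by (auto simp: contains_biclique_def subgraph_def complete_bipartite_def finite_simple_graph_def
      intro!: exI[of _ "{}"])

lemma biclique_number_induced_subgraph_le:
  assumes "finite_simple_graph G" "S \<subseteq> verts G"
  shows "biclique_number (induced_subgraph G S) \<le> biclique_number G"
  unfolding biclique_number_def
proof (rule Max_mono)
  show "{s. contains_biclique (induced_subgraph G S) s} \<subseteq> {s. contains_biclique G s}"
    using subgraph_induced_subgraph[OF assms] by (fastforce simp: contains_biclique_def subgraph_def)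
  show "{s. contains_biclique (induced_subgraph G S) s} \<noteq> {}"
    using contains_biclique_0 by blast
  show "finite {s. contains_biclique G s}"
    using assms(1) by (rule finite_contains_biclique)
qed

text \<open>Halving such a clique would give a biclique with sides larger than the biclique
  number.\<close>

lemma no_large_clique:
  assumes G: "finite_simple_graph G"
  shows "\<not> (\<exists>K\<subseteq>verts G. card K = 2 * Suc (biclique_number G) \<and> clique K (edges G))"
proof
  let ?s = "Suc (biclique_number G)"
  assume "\<exists>K\<subseteq>verts G. card K = 2 * ?s \<and> clique K (edges G)"
  then obtain K where K: "K \<subseteq> verts G" "card K = 2 * ?s" "clique K (edges G)" by blast
  have finK: "finite K" using K(2) by (metis card.infinite mult_is_0 nat.distinct(1) numeral_2_eq_2)
  obtain A where A: "A \<subseteq> K" "card A = ?s" "finite A"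
    using obtain_subset_with_card_n[of ?s K] K(2) finK finite_subset by (metis le_add1 mult_2)
  have B: "card (K - A) = ?s" using A K finK by (simp add: card_Diff_subset)
  have edge: "{a, b} \<in> edges G" if "a \<in> A" "b \<in> K - A" for a b
    using K(3) A(1) that by (auto simp: clique_def)
  have "subgraph (complete_bipartite A (K - A)) G"
    unfolding subgraph_def
  proof (intro conjI)
    show "finite_simple_graph (complete_bipartite A (K - A))"
      using finK A by (auto simp: finite_simple_graph_def complete_bipartite_def card_2_iff)
    show "verts (complete_bipartite A (K - A)) \<subseteq> verts G"
      using K A by (auto simp: complete_bipartite_def)
    show "edges (complete_bipartite A (K - A)) \<subseteq> edges G"
      using edge by (auto simp: complete_bipartite_def)
  qed
  then have "contains_biclique G ?s"
    unfolding contains_biclique_def using A B finK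
    by (intro exI[of _ A] exI[of _ "K - A"]) auto
  then have "?s \<le> biclique_number G"
    unfolding biclique_number_def using finite_contains_biclique[OF G] by (intro Max_ge) auto
  then show False by simp
qed

section \<open>From a monochromatic pair to the degeneracy bound\<close>

text \<open>Since \<open>card B < card A\<close>, the degree sum of at most
  \<open>2 * d * card (A \<union> B)\<close> is at most \<open>4 * d * card A\<close>, so not all
  vertices of \<open>A\<close> can exceed \<open>4 * d\<close>.\<close>

lemma degenerate_pair_low_degree:
  assumes "finite A" "finite B" "A \<inter> B = {}" "card B < card A" "degenerate E (A \<union> B) d"
  shows "\<exists>a\<in>A. card (nbrs E B a) \<le> 4 * d"
proof (rule ccontr)
  assume "\<not> ?thesis"
  then have deg: "4 * d < card (nbrs E B a)" if "a \<in> A" for a using that by (auto simp: not_le)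
  have "4 * d * card A = (\<Sum>a\<in>A. 4 * d)" by simp
  also have "\<dots> < (\<Sum>a\<in>A. card (nbrs E (A \<union> B) a))"
  proof (rule sum_strict_mono)
    fix a assume "a \<in> A"
    have "card (nbrs E B a) \<le> card (nbrs E (A \<union> B) a)"
      using assms by (intro card_mono) (auto simp: nbrs_def)
    with deg[OF \<open>a \<in> A\<close>] show "4 * d < card (nbrs E (A \<union> B) a)" by linarith
  qed (use assms in auto)
  also have "\<dots> \<le> (\<Sum>v\<in>A \<union> B. card (nbrs E (A \<union> B) v))"
    using assms by (intro sum_mono2) auto
  also have "\<dots> \<le> 2 * d * card (A \<union> B)"
    using assms by (intro degenerate_sum_degrees_le) auto
  also have "\<dots> \<le> 2 * d * (2 * card A)"
    using assms by (intro mult_le_mono2) (simp add: card_Un_disjoint)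
  finally show False by simp
qed

lemma extension_degeneracy_bound:
  fixes \<G> :: "'a graph set" and g :: "nat \<Rightarrow> nat" and k \<tau> :: nat
  assumes g: "\<And>H. H \<in> \<G> \<Longrightarrow> degeneracy H \<le> g (biclique_number H)" and k: "k \<ge> 1"
  shows "\<exists>D0. \<forall>G\<in>extension \<G> k. biclique_number G = \<tau> \<longrightarrow> degeneracy G \<le> D0"
proof -
  \<comment> \<open>An induced subgraph may have a smaller biclique number, and \<open>g\<close>
    need not be monotone.\<close>
  define d where "d = Max (g ` {..\<tau>})"
  \<comment> \<open>One more than the degree that \<open>degenerate_pair_low_degree\<close> allows
    for some vertex of \<open>A\<close>.\<close>
  define r where "r = Suc (4 * d)"
  have r1: "r \<ge> 1" by (simp add: r_def)
  obtain D0 where D0: "\<forall>D\<ge>D0. \<forall>(V :: 'a set) E \<phi>.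
    finite V \<and> V \<noteq> {} \<and> \<not> (\<exists>K\<subseteq>V. card K = 2 * Suc \<tau> \<and> clique K E) \<and> degenerate E V D \<and>
    (\<forall>v\<in>V. D \<le> card (nbrs E V v) \<and> (\<forall>u\<in>nbrs E V v. \<phi> {u, v} \<in> {1..k})) \<longrightarrow>
    (\<exists>A B c. A \<subseteq> V \<and> B \<subseteq> V \<and> A \<inter> B = {} \<and> indep A E \<and> indep B E \<and> card B < card A \<and>
      (\<forall>a\<in>A. card (nbrs E B a) = r \<and> (\<forall>u\<in>nbrs E B a. \<phi> {u, a} = c)))"
    using monochromatic_dense_pair[OF k r1, of "2 * Suc \<tau>"] by (elim exE) (rule that)
  show ?thesis
  proof (intro exI[of _ D0] ballI impI)
    fix G assume "G \<in> extension \<G> k" and \<tau>: "biclique_number G = \<tau>"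
    then obtain \<phi> where G: "finite_simple_graph G" and \<phi>: "\<phi> \<in> edges G \<rightarrow> {1..k}"
      and mono: "\<And>S. S \<subseteq> verts G \<Longrightarrow> Defs.monochromatic \<phi> (induced_subgraph G S) \<Longrightarrow>
        induced_subgraph G S \<in> \<G>"
      by (auto simp: extension_def colourable_def)
    have finG: "finite (verts G)" using G by (simp add: finite_simple_graph_def)
    show "degeneracy G \<le> D0"
    proof (rule ccontr)
      assume big: "\<not> degeneracy G \<le> D0"
      let ?E = "edges G"
      obtain V where V: "V \<subseteq> verts G" "V \<noteq> {}" "\<And>v. v \<in> V \<Longrightarrow> degeneracy G \<le> card (nbrs ?E V v)"
        using degeneracy_core[OF G] big by (metis gr0I le0)
      have finV: "finite V" using V(1) finG finite_subset by blast
      have "\<exists>A B c. A \<subseteq> V \<and> B \<subseteq> V \<and> A \<inter> B = {} \<and> indep A ?E \<and> indep B ?E \<and> card B < card A \<and>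
          (\<forall>a\<in>A. card (nbrs ?E B a) = r \<and> (\<forall>u\<in>nbrs ?E B a. \<phi> {u, a} = c))"
      \<comment> \<open>The degeneracy of \<open>G\<close> serves both as the minimum degree of the
        core \<open>V\<close> and as the degeneracy bound inherited by \<open>V\<close>.\<close>
      proof (rule D0[THEN spec, of "degeneracy G", THEN mp, THEN spec, THEN spec, THEN spec, THEN mp])
        have "\<not> (\<exists>K\<subseteq>V. card K = 2 * Suc \<tau> \<and> clique K ?E)"
          using no_large_clique[OF G] V(1) unfolding \<tau> by blast
        moreover have "degenerate ?E V (degeneracy G)"
          using degenerate_degeneracy[OF G] V(1) by (auto simp: degenerate_def)
        moreover have "\<phi> {u, v} \<in> {1..k}" if "u \<in> nbrs ?E V v" for u v
          using \<phi> that by (auto simp: nbrs_def)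
        ultimately show "finite V \<and> V \<noteq> {} \<and> \<not> (\<exists>K\<subseteq>V. card K = 2 * Suc \<tau> \<and> clique K ?E) \<and>
            degenerate ?E V (degeneracy G) \<and>
            (\<forall>v\<in>V. degeneracy G \<le> card (nbrs ?E V v) \<and> (\<forall>u\<in>nbrs ?E V v. \<phi> {u, v} \<in> {1..k}))"
          using finV V(2,3) by blast
      qed (use big in simp)
      then obtain A B c where AB: "A \<subseteq> V" "B \<subseteq> V" "A \<inter> B = {}" "indep A ?E" "indep B ?E"
        "card B < card A" "\<And>a. a \<in> A \<Longrightarrow> card (nbrs ?E B a) = r"
        "\<And>a u. a \<in> A \<Longrightarrow> u \<in> nbrs ?E B a \<Longrightarrow> \<phi> {u, a} = c" by blast
      define H where "H = induced_subgraph G (A \<union> B)"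
      have W: "A \<union> B \<subseteq> verts G" using AB V(1) by blast
      have vH: "verts H = A \<union> B" by (simp add: H_def induced_subgraph_def)
      have simpleH: "finite_simple_graph H"
        using subgraph_induced_subgraph[OF G W] by (simp add: H_def subgraph_def)
      \<comment> \<open>As \<open>A\<close> and \<open>B\<close> are independent, every edge of
        \<open>H\<close> joins \<open>A\<close> to \<open>B\<close> and so has colour
        \<open>c\<close>.\<close>
      have colour: "\<phi> e = c" if "e \<in> edges H" for e
      proof -
        have e: "e \<in> ?E" "e \<subseteq> A \<union> B" using that by (auto simp: H_def induced_subgraph_def)
        then have "card e = 2" using G by (auto simp: finite_simple_graph_def)
        then obtain x y where xy: "e = {x, y}" "x \<noteq> y" by (auto simp: card_2_iff)
        then have "\<not> (x \<in> A \<and> y \<in> A)" "\<not> (x \<in> B \<and> y \<in> B)"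
          using AB(4,5) e(1) by (auto simp: indep_def)
        then consider "x \<in> A" "y \<in> B" | "x \<in> B" "y \<in> A" using e(2) xy(1) by blast
        then show ?thesis
        proof cases
          case 1
          then have "y \<in> nbrs ?E B x" using xy e(1) by (auto simp: nbrs_def insert_commute)
          with AB(8)[OF 1(1)] have "\<phi> {y, x} = c" by blast
          then show ?thesis by (simp add: xy insert_commute)
        next
          case 2
          then have "x \<in> nbrs ?E B y" using xy e(1) by (auto simp: nbrs_def)
          with AB(8)[OF 2(2)] show ?thesis by (auto simp: xy)
        qed
      qed
      then have "Defs.monochromatic \<phi> H" by (simp add: Defs.monochromatic_def)
      then have "H \<in> \<G>" using mono[OF W] by (simp add: H_def)
      then have "degeneracy H \<le> g (biclique_number H)" by (rule g)
      also have "\<dots> \<le> d"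
        unfolding d_def using biclique_number_induced_subgraph_le[OF G W] \<tau>
        by (intro Max_ge) (auto simp: H_def)
      finally have "degeneracy H \<le> d" .
      moreover have "degenerate (edges H) (A \<union> B) (degeneracy H)"
        using degenerate_degeneracy[OF simpleH] by (simp add: vH)
      ultimately have "degenerate (edges H) (A \<union> B) d"
        by (meson degenerate_def order_trans)
      then obtain a where "a \<in> A" "card (nbrs (edges H) B a) \<le> 4 * d"
        using degenerate_pair_low_degree[of A B "edges H" d] AB finV finite_subset by metis
      moreover have "nbrs (edges H) B a = nbrs ?E B a"
        using nbrs_induced_subgraph[of B "A \<union> B" G a] \<open>a \<in> A\<close> by (simp add: H_def)
      ultimately show False using AB(7)[of a] by (simp add: r_def)
    qed
  qed
qed

theorem corollary1p3:
  fixes \<G> :: "'a graph set" and k :: nat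
  assumes "hereditary \<G>"
    and "k \<ge> 1"
    and "degree_bounded \<G>"
  shows "degree_bounded (extension \<G> k)"
proof -
  obtain g where g: "\<And>H. H \<in> \<G> \<Longrightarrow> degeneracy H \<le> g (biclique_number H)"
    using assms(3) by (auto simp: degree_bounded_def)
  have "\<forall>\<tau>. \<exists>D0. \<forall>G\<in>extension \<G> k. biclique_number G = \<tau> \<longrightarrow> degeneracy G \<le> D0"
    using extension_degeneracy_bound[OF g assms(2)] by blast
  then obtain h where "\<And>\<tau> G. G \<in> extension \<G> k \<Longrightarrow> biclique_number G = \<tau> \<Longrightarrow> degeneracy G \<le> h \<tau>"
    by metis
  then show ?thesis unfolding degree_bounded_def by blast
qed

end
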